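(* The following decomposition results hold for the systems $\mathsf{SKSq}$ and $\mathsf{KSq}$ for predicate logic. Write $A\Rightarrow_{\mathcal S}B$ for "there is a derivation in $\mathcal S$ with premise $A$ and conclusion $B$". \begin{enumerate} \item If $T\Rightarrow_{\mathsf{SKSq}}R$, then there are structures $V,U$ with $T\Rightarrow_{\{ai\downarrow\}}V\Rightarrow_{\mathsf{SKSq}\setminus\{ai\downarrow,ai\uparrow\}}U\Rightarrow_{\{ai\uparrow\}}R$. \item If $\mathsf t\Rightarrow_{\mathsf{KSq}}S$, then there is a structure $S'$ with $\mathsf t\Rightarrow_{\mathsf{KSq}\setminus\{ac\downarrow\}}S'\Rightarrow_{\{ac\downarrow\}}S$. \item If $T\Rightarrow_{\mathsf{SKSq}}R$, then there are structures $V,U$ with $T\Rightarrow_{\{ac\uparrow\}}V\Rightarrow_{\mathsf{SKSq}\setminus\{ac\downarrow,ac\uparrow\}}U\Rightarrow_{\{ac\downarrow\}}R$. \item If $\mathsf t\Rightarrow_{\mathsf{KSq}}S$, then there is a structure $S'$ with $\mathsf t\Rightarrow_{\mathsf{KSq}\setminus\{aw\downarrow\}}S'\Rightarrow_{\{aw\downarrow\}}S$. \item If $T\Rightarrow_{\mathsf{SKSq}}R$, then there are structures $V,U$ with $T\Rightarrow_{\{aw\uparrow\}}V\Rightarrow_{\mathsf{SKSq}\setminus\{aw\downarrow,aw\uparrow\}}U\Rightarrow_{\{aw\downarrow\}}R$. \item If $T\Rightarrow_{\mathsf{SKSq}}R$, then there are structures $T_1,T_2,T_3,R_3,R_2,R_1$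 with $T\Rightarrow_{\{ac\uparrow\}}T_1\Rightarrow_{\{aw\uparrow\}}T_2\Rightarrow_{\{ai\downarrow\}}T_3\Rightarrow_{\mathcal Q}R_3\Rightarrow_{\{ai\uparrow\}}R_2\Rightarrow_{\{aw\downarrow\}}R_1\Rightarrow_{\{ac\downarrow\}}R$, where $\mathcal Q=\{s,m,u{\downarrow},u{\uparrow},l_1{\downarrow},l_1{\uparrow},l_2{\downarrow},l_2{\uparrow},n{\downarrow},n{\uparrow}\}$. \end{enumerate}
   Context: First-order terms are as usual; atoms are expressions $p(t_1,\dots,t_n)$ with $p$ a predicate symbol of arity $n$, and the negation of an atom is again an atom. Structures: $S ::= \mathsf f \mid \mathsf t \mid a \mid [S,\dots,S] \mid (S,\dots,S) \mid \bar S \mid \exists x S \mid \forall x S$ (non-empty lists), with $[\cdot]$ disjunction, $(\cdot)$ conjunction, $\bar S$ negation. A context $S\{\ \}$ is a structure with one occurrence of a hole, not in the scope of a negation; $S\{R\}$ fills the hole with $R$ (quantifiers of $S$ may capture variables of $R$); $S[R,T]$ abbreviates $S\{[R,T]\}$, $S(R,T)$ abbreviates $S\{(R,T)\}$. $R[x/t]$ denotes substitution of the term $t$ for $x$ in $R$, where $t$ must be free for $x$ in $R$. Equivalent structures are not distinguished; equivalence is the smallest equivalence relation induced by: $[\vec R,[\vec T],\vec U]=[\vec R,\vec T,\vec U]$, $(\vec R,(\vec T),\vec U)=(\vec R,\vec T,\vec U)$ ($\vec T$ non-empty); $[R,T]=[T,R]$, $(R,T)=(T,R)$; $(\mathsf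 f,\mathsf f)=\mathsf f$, $[\mathsf f,R]=R$, $[\mathsf t,\mathsf t]=\mathsf t$, $(\mathsf t,R)=R$; $\bar{\mathsf f}=\mathsf t$, $\bar{\mathsf t}=\mathsf f$, $\overline{[R,T]}=(\bar R,\bar T)$, $\overline{(R,T)}=[\bar R,\bar T]$, $\bar{\bar R}=R$, $\overline{\exists xR}=\forall x\bar R$, $\overline{\forall xR}=\exists x\bar R$; $\forall xR=\forall yR[x/y]$ and $\exists xR=\exists yR[x/y]$ if $y$ is not free in $R$; $\forall yR=\exists yR=R$ if $y$ is not free in $R$; and closure: if $R=T$ then $S\{R\}=S\{T\}$ and $\bar R=\bar T$. A derivation in a system (set of inference rules) is a finite sequence of rule instances, read top-down, the conclusion of each being the premise of the next; it may consist of a single structure. Its premise is the topmost structure, its conclusion the bottommost. (A derivation with premise $\mathsf t$ is called a proof of its conclusion.) System $\mathsf{SKSq}$ has the rules (written $\frac{\text{premise}}{\text{conclusion}}$; $a$ an atom, $R,T,U,V$ structures): $ai{\downarrow}:\frac{S\{\mathsf t\}}{S[a,\bar a]}$, $ai{\uparrow}:\frac{S(a,\bar a)}{S\{\mathsf f\}}$, $aw{\downarrow}:\frac{S\{\mathsf f\}}{S\{a\}}$, $aw{\uparrow}:\frac{S\{a\}}{S\{\mathsf t\}}$, $ac{\downarrow}:\frac{S[a,a]}{S\{a\}}$, $ac{\uparrow}:\frac{S\{a\}}{S(a,a)}$, $s:\frac{S([R,U],T)}{S[(R,T),U]}$, $m:\frac{S[(R,U),(T,V)]}{S([R,T],[U,V])}$,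 $u{\downarrow}:\frac{S\{\forall x[R,T]\}}{S[\forall xR,\exists xT]}$, $u{\uparrow}:\frac{S(\exists xR,\forall xT)}{S\{\exists x(R,T)\}}$, $n{\downarrow}:\frac{S\{R[x/t]\}}{S\{\exists xR\}}$, $n{\uparrow}:\frac{S\{\forall xR\}}{S\{R[x/t]\}}$, $l_1{\downarrow}:\frac{S[\exists xR,\exists xT]}{S\{\exists x[R,T]\}}$, $l_1{\uparrow}:\frac{S\{\forall x(R,T)\}}{S(\forall xR,\forall xT)}$, $l_2{\downarrow}:\frac{S[\forall xR,\forall xT]}{S\{\forall x[R,T]\}}$, $l_2{\uparrow}:\frac{S\{\exists x(R,T)\}}{S(\exists xR,\exists xT)}$. System $\mathsf{KSq}$ is $\{ai{\downarrow},s,m,aw{\downarrow},ac{\downarrow},u{\downarrow},l_1{\downarrow},l_2{\downarrow},n{\downarrow}\}$. *)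

theory Defs
  imports Main
begin

type_synonym var = nat

datatype 'f trm = Var var | Fun 'f "'f trm list"

text \<open>Conjunctions and disjunctions are non-empty lists of structures, and symbols are used with their
  arities. Neither is enforced by the datatype; see \<open>well_formed\<close> below.\<close>

datatype ('f, 'p) struc =
    FF | TT
  | Pred 'p "'f trm list"
  | Dis "('f, 'p) struc list"
  | Con "('f, 'p) struc list"
  | Neg "('f, 'p) struc"
  | Ex var "('f, 'p) struc"
  | All var "('f, 'p) struc"

text \<open>The negation of an atom is again an atom.\<close>

inductive is_atom :: "('f, 'p) struc \<Rightarrow> bool" where
  "is_atom (Pred p ts)"
| "is_atom a \<Longrightarrow> is_atom (Neg a)"


text \<open>A signature is given by the function and predicate symbols paired with their arities.\<close>

fun well_formed_trm :: "('f \<times> nat) set \<Rightarrow> 'f trm \<Rightarrow> bool" where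
  "well_formed_trm F (Var x) \<longleftrightarrow> True"
| "well_formed_trm F (Fun f ts) \<longleftrightarrow> (f, length ts) \<in> F \<and> (\<forall>t\<in>set ts. well_formed_trm F t)"

fun well_formed :: "('f \<times> nat) set \<Rightarrow> ('p \<times> nat) set \<Rightarrow> ('f, 'p) struc \<Rightarrow> bool" where
  "well_formed F P FF \<longleftrightarrow> True"
| "well_formed F P TT \<longleftrightarrow> True"
| "well_formed F P (Pred p ts) \<longleftrightarrow> (p, length ts) \<in> P \<and> (\<forall>t\<in>set ts. well_formed_trm F t)"
| "well_formed F P (Dis Rs) \<longleftrightarrow> Rs \<noteq> [] \<and> (\<forall>R\<in>set Rs. well_formed F P R)"
| "well_formed F P (Con Rs) \<longleftrightarrow> Rs \<noteq> [] \<and> (\<forall>R\<in>set Rs. well_formed F P R)"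
| "well_formed F P (Neg R) \<longleftrightarrow> well_formed F P R"
| "well_formed F P (Ex x R) \<longleftrightarrow> well_formed F P R"
| "well_formed F P (All x R) \<longleftrightarrow> well_formed F P R"


fun vars_trm :: "'f trm \<Rightarrow> var set" where
  "vars_trm (Var x) = {x}"
| "vars_trm (Fun f ts) = (\<Union>t\<in>set ts. vars_trm t)"

fun free_vars :: "('f, 'p) struc \<Rightarrow> var set" where
  "free_vars FF = {}"
| "free_vars TT = {}"
| "free_vars (Pred p ts) = (\<Union>t\<in>set ts. vars_trm t)"
| "free_vars (Dis Rs) = (\<Union>R\<in>set Rs. free_vars R)"
| "free_vars (Con Rs) = (\<Union>R\<in>set Rs. free_vars R)"
| "free_vars (Neg R) = free_vars R"
| "free_vars (Ex x R) = free_vars R - {x}"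
| "free_vars (All x R) = free_vars R - {x}"

fun subst_trm :: "var \<Rightarrow> 'f trm \<Rightarrow> 'f trm \<Rightarrow> 'f trm" where
  "subst_trm x t (Var y) = (if y = x then t else Var y)"
| "subst_trm x t (Fun f ts) = Fun f (map (subst_trm x t) ts)"

text \<open>\<open>subst x t R\<close> is $R[x/t]$. It does not rename bound variables, so it is only meaningful
  together with \<open>free_for t x R\<close>.\<close>

fun subst :: "var \<Rightarrow> 'f trm \<Rightarrow> ('f, 'p) struc \<Rightarrow> ('f, 'p) struc" where
  "subst x t FF = FF"
| "subst x t TT = TT"
| "subst x t (Pred p ts) = Pred p (map (subst_trm x t) ts)"
| "subst x t (Dis Rs) = Dis (map (subst x t) Rs)"
| "subst x t (Con Rs) = Con (map (subst x t) Rs)"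
| "subst x t (Neg R) = Neg (subst x t R)"
| "subst x t (Ex y R) = Ex y (if y = x then R else subst x t R)"
| "subst x t (All y R) = All y (if y = x then R else subst x t R)"

fun free_for :: "'f trm \<Rightarrow> var \<Rightarrow> ('f, 'p) struc \<Rightarrow> bool" where
  "free_for t x FF \<longleftrightarrow> True"
| "free_for t x TT \<longleftrightarrow> True"
| "free_for t x (Pred p ts) \<longleftrightarrow> True"
| "free_for t x (Dis Rs) \<longleftrightarrow> (\<forall>R\<in>set Rs. free_for t x R)"
| "free_for t x (Con Rs) \<longleftrightarrow> (\<forall>R\<in>set Rs. free_for t x R)"
| "free_for t x (Neg R) \<longleftrightarrow> free_for t x R"
| "free_for t x (Ex y R) \<longleftrightarrow> x \<notin> free_vars (Ex y R) \<or> y \<notin> vars_trm t \<and> free_for t x R"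
| "free_for t x (All y R) \<longleftrightarrow> x \<notin> free_vars (All y R) \<or> y \<notin> vars_trm t \<and> free_for t x R"


text \<open>There is no constructor for negation: the hole is never in the scope of one.\<close>

datatype ('f, 'p) ctx =
    Hole
  | CDis "('f, 'p) struc list" "('f, 'p) ctx" "('f, 'p) struc list"
  | CCon "('f, 'p) struc list" "('f, 'p) ctx" "('f, 'p) struc list"
  | CEx var "('f, 'p) ctx"
  | CAll var "('f, 'p) ctx"

text \<open>Quantifiers of the context may capture variables of the structure.\<close>

fun fill :: "('f, 'p) ctx \<Rightarrow> ('f, 'p) struc \<Rightarrow> ('f, 'p) struc" where
  "fill Hole R = R"
| "fill (CDis Rs S Us) R = Dis (Rs @ fill S R # Us)"
| "fill (CCon Rs S Us) R = Con (Rs @ fill S R # Us)"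
| "fill (CEx x S) R = Ex x (fill S R)"
| "fill (CAll x S) R = All x (fill S R)"


inductive equ :: "('f, 'p) struc \<Rightarrow> ('f, 'p) struc \<Rightarrow> bool" (infix "=\<^sub>s" 50) where
  refl: "R =\<^sub>s R"
| sym: "R =\<^sub>s T \<Longrightarrow> T =\<^sub>s R"
| trans: "R =\<^sub>s T \<Longrightarrow> T =\<^sub>s U \<Longrightarrow> R =\<^sub>s U"
| dis_assoc: "Ts \<noteq> [] \<Longrightarrow> Dis (Rs @ Dis Ts # Us) =\<^sub>s Dis (Rs @ Ts @ Us)"
| con_assoc: "Ts \<noteq> [] \<Longrightarrow> Con (Rs @ Con Ts # Us) =\<^sub>s Con (Rs @ Ts @ Us)"
| dis_comm: "Dis [R, T] =\<^sub>s Dis [T, R]"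
| con_comm: "Con [R, T] =\<^sub>s Con [T, R]"
| con_FF: "Con [FF, FF] =\<^sub>s FF"
| dis_FF: "Dis [FF, R] =\<^sub>s R"
| dis_TT: "Dis [TT, TT] =\<^sub>s TT"
| con_TT: "Con [TT, R] =\<^sub>s R"
| neg_FF: "Neg FF =\<^sub>s TT"
| neg_TT: "Neg TT =\<^sub>s FF"
| neg_dis: "Neg (Dis [R, T]) =\<^sub>s Con [Neg R, Neg T]"
| neg_con: "Neg (Con [R, T]) =\<^sub>s Dis [Neg R, Neg T]"
| neg_neg: "Neg (Neg R) =\<^sub>s R"
| neg_ex: "Neg (Ex x R) =\<^sub>s All x (Neg R)"
| neg_all: "Neg (All x R) =\<^sub>s Ex x (Neg R)"
| rename_all: "y \<notin> free_vars R \<Longrightarrow> free_for (Var y) x R \<Longrightarrow> All x R =\<^sub>s All y (subst x (Var y) R)"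
| rename_ex: "y \<notin> free_vars R \<Longrightarrow> free_for (Var y) x R \<Longrightarrow> Ex x R =\<^sub>s Ex y (subst x (Var y) R)"
| vacuous_all: "y \<notin> free_vars R \<Longrightarrow> All y R =\<^sub>s R"
| vacuous_ex: "y \<notin> free_vars R \<Longrightarrow> Ex y R =\<^sub>s R"
| context_closure: "R =\<^sub>s T \<Longrightarrow> fill S R =\<^sub>s fill S T"
| neg_closure: "R =\<^sub>s T \<Longrightarrow> Neg R =\<^sub>s Neg T"

text \<open>Every equation preserves well-formedness in both directions. Hence the restriction of
  \<open>=\<^sub>s\<close> to well-formed structures is the equivalence generated on well-formed structures alone.\<close>

lemma well_formed_subst_trm:
  "well_formed_trm F (subst_trm x (Var y) t) \<longleftrightarrow> well_formed_trm F t"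
  by (induction t) auto

lemma well_formed_subst:
  "well_formed F P (subst x (Var y) R) \<longleftrightarrow> well_formed F P R"
  by (induction R) (auto simp: well_formed_subst_trm)

lemma well_formed_fill_cong:
  "well_formed F P R \<longleftrightarrow> well_formed F P T \<Longrightarrow>
   well_formed F P (fill S R) \<longleftrightarrow> well_formed F P (fill S T)"
  by (induction S) auto

lemma equ_well_formed: "R =\<^sub>s T \<Longrightarrow> well_formed F P R \<longleftrightarrow> well_formed F P T"
  by (induction rule: equ.induct) (auto simp: well_formed_subst cong: well_formed_fill_cong)


datatype rule =
    ai_down | ai_up | aw_down | aw_up | ac_down | ac_up
  | switch | medial
  | u_down | u_up | n_down | n_up
  | l1_down | l1_up | l2_down | l2_up

inductive rule_instance :: "rule \<Rightarrow> ('f, 'p) struc \<Rightarrow> ('f, 'p) struc \<Rightarrow> bool" where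
  "is_atom a \<Longrightarrow> rule_instance ai_down (fill S TT) (fill S (Dis [a, Neg a]))"
| "is_atom a \<Longrightarrow> rule_instance ai_up (fill S (Con [a, Neg a])) (fill S FF)"
| "is_atom a \<Longrightarrow> rule_instance aw_down (fill S FF) (fill S a)"
| "is_atom a \<Longrightarrow> rule_instance aw_up (fill S a) (fill S TT)"
| "is_atom a \<Longrightarrow> rule_instance ac_down (fill S (Dis [a, a])) (fill S a)"
| "is_atom a \<Longrightarrow> rule_instance ac_up (fill S a) (fill S (Con [a, a]))"
| "rule_instance switch (fill S (Con [Dis [R, U], T])) (fill S (Dis [Con [R, T], U]))"
| "rule_instance medial
     (fill S (Dis [Con [R, U], Con [T, V]])) (fill S (Con [Dis [R, T], Dis [U, V]]))"
| "rule_instance u_down (fill S (All x (Dis [R, T]))) (fill S (Dis [All x R, Ex x T]))"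
| "rule_instance u_up (fill S (Con [Ex x R, All x T])) (fill S (Ex x (Con [R, T])))"
| "free_for t x R \<Longrightarrow> rule_instance n_down (fill S (subst x t R)) (fill S (Ex x R))"
| "free_for t x R \<Longrightarrow> rule_instance n_up (fill S (All x R)) (fill S (subst x t R))"
| "rule_instance l1_down (fill S (Dis [Ex x R, Ex x T])) (fill S (Ex x (Dis [R, T])))"
| "rule_instance l1_up (fill S (All x (Con [R, T]))) (fill S (Con [All x R, All x T]))"
| "rule_instance l2_down (fill S (Dis [All x R, All x T])) (fill S (All x (Dis [R, T])))"
| "rule_instance l2_up (fill S (Ex x (Con [R, T]))) (fill S (Con [Ex x R, Ex x T]))"

definition SKSq :: "rule set" where
  "SKSq = {ai_down, ai_up, aw_down, aw_up, ac_down, ac_up, switch, medial,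
           u_down, u_up, n_down, n_up, l1_down, l1_up, l2_down, l2_up}"

definition KSq :: "rule set" where
  "KSq = {ai_down, switch, medial, aw_down, ac_down, u_down, l1_down, l2_down, n_down}"


text \<open>Equivalent structures are not distinguished, so the premise and the conclusion of a rule
  instance may be replaced by equivalent structures, and so may those of a derivation. In
  particular, a derivation consisting of a single structure leads from any structure to any
  equivalent one.\<close>

definition step :: "rule set \<Rightarrow> ('f, 'p) struc \<Rightarrow> ('f, 'p) struc \<Rightarrow> bool" where
  "step \<S> A B \<longleftrightarrow> (\<exists>\<rho>\<in>\<S>. \<exists>A' B'. A =\<^sub>s A' \<and> rule_instance \<rho> A' B' \<and> B' =\<^sub>s B)"

definition derivation ::
    "('f \<times> nat) set \<Rightarrow> ('p \<times> nat) set \<Rightarrow> rule set \<Rightarrow> ('f, 'p) struc list \<Rightarrow> bool" where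
  "derivation F P \<S> \<Delta> \<longleftrightarrow>
     \<Delta> \<noteq> [] \<and> (\<forall>S\<in>set \<Delta>. well_formed F P S) \<and> successively (step \<S>) \<Delta>"

definition derives ::
    "('f \<times> nat) set \<Rightarrow> ('p \<times> nat) set \<Rightarrow> rule set \<Rightarrow> ('f, 'p) struc \<Rightarrow> ('f, 'p) struc \<Rightarrow> bool" where
  "derives F P \<S> A B \<longleftrightarrow> (\<exists>\<Delta>. derivation F P \<S> \<Delta> \<and> hd \<Delta> =\<^sub>s A \<and> last \<Delta> =\<^sub>s B)"

end

theory Submission
  imports Defs "HOL-Library.Countable_Set"
begin

text \<open>All rules are sound in Herbrand structures, so a derivation from \<open>T\<close> to \<open>R\<close> makes the
  disjunction of \<open>R\<close> and the negation of \<open>T\<close> valid. By completeness of a cut-free sequent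
  calculus (shown by a Henkin construction) this disjunction is provable without cut, and such a
  proof turns into a derivation that starts with \<open>ai_down\<close>, continues with rules without atomic
  contraction or weakening and ends in an expansion \<open>[D, E]\<close> of the disjunction: every literal is
  replaced by a disjunction of copies of itself and of \<open>f\<close>. Contexts shared by the premises of a
  sequent rule are merged by medial and its quantifier analogues, so that only literals get
  duplicated. Atomic contraction and weakening, in either order, lead from \<open>E\<close> to \<open>R\<close> and dually
  from \<open>T\<close> to the negation of \<open>D\<close>. Finally the cut between \<open>D\<close> and its negation is reduced to
  atomic cuts, which can all be done last.\<close>

section \<open>Equivalence and derivations\<close>

text \<open>The given derivation is used only through the validity of the implication that it
  establishes, so no instance in it is ever permuted. The obstacle is that the middle phase may
  neither contract nor weaken, whereas sequent proofs do both. Contraction of a whole formula is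
  pushed down to the literals, where the two copies are simply left side by side. Weakening by a
  whole formula inserts that formula with all literals turned into \<open>f\<close>; the equations
  collapse it to \<open>f\<close> or \<open>t\<close>, and \<open>f\<close> yields \<open>t\<close>
  by switch alone. The order of contraction and weakening is free because the leaves
  \<open>f\<close> in the expansion of a literal can either be weakened to the literal before
  everything is contracted, or vanish by unit equations while the copies are contracted, so that
  weakening is left only for literals without any copy. Two further concerns are removed before the
  Henkin construction starts: the signature may be uncountable, and bound variables may clash with
  free ones.\<close>

lemmas [trans] = equ.trans

lemma equ_dis_cong: "R =\<^sub>s R' \<Longrightarrow> T =\<^sub>s T' \<Longrightarrow> Dis [R, T] =\<^sub>s Dis [R', T']"
  using context_closure[of R R' "CDis [] Hole [T]"] context_closure[of T T' "CDis [R'] Hole []"]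
  by (auto intro: equ.trans)

lemma equ_con_cong: "R =\<^sub>s R' \<Longrightarrow> T =\<^sub>s T' \<Longrightarrow> Con [R, T] =\<^sub>s Con [R', T']"
  using context_closure[of R R' "CCon [] Hole [T]"] context_closure[of T T' "CCon [R'] Hole []"]
  by (auto intro: equ.trans)

lemma equ_ex_cong: "R =\<^sub>s R' \<Longrightarrow> Ex x R =\<^sub>s Ex x R'"
  using context_closure[of R R' "CEx x Hole"] by simp

lemma equ_all_cong: "R =\<^sub>s R' \<Longrightarrow> All x R =\<^sub>s All x R'"
  using context_closure[of R R' "CAll x Hole"] by simp

lemma equ_dis_FF_right: "Dis [R, FF] =\<^sub>s R"
  by (rule equ.trans[OF dis_comm dis_FF])

lemma equ_con_TT_right: "Con [R, TT] =\<^sub>s R"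
  by (rule equ.trans[OF con_comm con_TT])

lemma equ_dis_assoc: "Dis [Dis [R, T], U] =\<^sub>s Dis [R, Dis [T, U]]"
  using dis_assoc[of "[R, T]" "[]" "[U]"] dis_assoc[of "[T, U]" "[R]" "[]"]
  by (auto intro: equ.trans equ.sym)

lemma equ_con_assoc: "Con [Con [R, T], U] =\<^sub>s Con [R, Con [T, U]]"
  using con_assoc[of "[R, T]" "[]" "[U]"] con_assoc[of "[T, U]" "[R]" "[]"]
  by (auto intro: equ.trans equ.sym)

text \<open>Regrouping componentwise reduces the merging of two copies of a disjunction to the
  merging of the copies of its disjuncts, without any rule.\<close>

lemma equ_dis_swap: "Dis [Dis [R, T], Dis [U, V]] =\<^sub>s Dis [Dis [R, U], Dis [T, V]]"
proof -
  have left_comm: "Dis [T, Dis [U, V]] =\<^sub>s Dis [U, Dis [T, V]]"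
    by (meson equ.sym equ.trans equ_dis_assoc equ_dis_cong dis_comm equ.refl)
  have "Dis [Dis [R, T], Dis [U, V]] =\<^sub>s Dis [R, Dis [T, Dis [U, V]]]"
    by (rule equ_dis_assoc)
  also have "\<dots> =\<^sub>s Dis [R, Dis [U, Dis [T, V]]]"
    by (rule equ_dis_cong[OF equ.refl left_comm])
  also have "\<dots> =\<^sub>s Dis [Dis [R, U], Dis [T, V]]"
    by (rule equ.sym[OF equ_dis_assoc])
  finally show ?thesis .
qed

text \<open>No equation speaks of one-element lists directly. Padding the element to
  \<open>[FF, R]\<close> creates a nested disjunction that associativity flattens, and the unit
  equation then removes \<open>FF\<close>.\<close>

lemma equ_dis_single: "Dis [R] =\<^sub>s R"
proof -
  have "Dis [R] =\<^sub>s Dis [Dis [FF, R]]"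
    using context_closure[OF equ.sym[OF dis_FF], of "CDis [] Hole []" R] by simp
  also have "\<dots> =\<^sub>s Dis [FF, R]"
    using dis_assoc[of "[FF, R]" "[]" "[]"] by simp
  also have "\<dots> =\<^sub>s R" by (rule dis_FF)
  finally show ?thesis .
qed

lemma equ_con_single: "Con [R] =\<^sub>s R"
proof -
  have "Con [R] =\<^sub>s Con [Con [TT, R]]"
    using context_closure[OF equ.sym[OF con_TT], of "CCon [] Hole []" R] by simp
  also have "\<dots> =\<^sub>s Con [TT, R]"
    using con_assoc[of "[TT, R]" "[]" "[]"] by simp
  also have "\<dots> =\<^sub>s R" by (rule con_TT)
  finally show ?thesis .
qed

lemma equ_dis_Cons: "Rs \<noteq> [] \<Longrightarrow> Dis (R # Rs) =\<^sub>s Dis [R, Dis Rs]"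
  using equ.sym[OF dis_assoc[of Rs "[R]" "[]"]] by simp

lemma equ_con_Cons: "Rs \<noteq> [] \<Longrightarrow> Con (R # Rs) =\<^sub>s Con [R, Con Rs]"
  using equ.sym[OF con_assoc[of Rs "[R]" "[]"]] by simp

section \<open>Closure of derivations under contexts and composition\<close>

fun comp_ctx :: "('f, 'p) ctx \<Rightarrow> ('f, 'p) ctx \<Rightarrow> ('f, 'p) ctx" where
  "comp_ctx Hole D = D"
| "comp_ctx (CDis Rs C Us) D = CDis Rs (comp_ctx C D) Us"
| "comp_ctx (CCon Rs C Us) D = CCon Rs (comp_ctx C D) Us"
| "comp_ctx (CEx x C) D = CEx x (comp_ctx C D)"
| "comp_ctx (CAll x C) D = CAll x (comp_ctx C D)"

lemma fill_comp_ctx: "fill (comp_ctx C D) R = fill C (fill D R)"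
  by (induction C) auto

text \<open>A rule instance brings its own context, so embedding it amounts to composing that
  context with \<open>C\<close>.\<close>

lemma rule_instance_fill: "rule_instance \<rho> A B \<Longrightarrow> rule_instance \<rho> (fill C A) (fill C B)"
  by (induction rule: rule_instance.induct)
    (simp_all only: fill_comp_ctx[symmetric] rule_instance.intros)

lemma step_fill: "step \<S> A B \<Longrightarrow> step \<S> (fill C A) (fill C B)"
  unfolding step_def by (meson rule_instance_fill context_closure)

lemma derives_well_formed:
  assumes "derives F P \<S> A B"
  shows "well_formed F P A" "well_formed F P B"
  using assms equ_well_formed unfolding derives_def derivation_def
  by (metis hd_in_set last_in_set)+

lemma derives_equ: "well_formed F P A \<Longrightarrow> A =\<^sub>s B \<Longrightarrow> derives F P \<S> A B"
  unfolding derives_def derivation_def by (intro exI[of _ "[A]"]) (auto intro: equ.refl)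

lemma derives_rule:
  "\<lbrakk>rule_instance \<rho> A B; \<rho> \<in> \<S>; well_formed F P A; well_formed F P B\<rbrakk> \<Longrightarrow> derives F P \<S> A B"
  unfolding derives_def derivation_def step_def
  by (intro exI[of _ "[A, B]"]) (auto intro: equ.refl)

lemma derives_trans [trans]:
  assumes "derives F P \<S> A B" "derives F P \<S> B C"
  shows "derives F P \<S> A C"
proof -
  obtain \<Delta> where \<Delta>: "derivation F P \<S> \<Delta>" "hd \<Delta> =\<^sub>s A" "last \<Delta> =\<^sub>s B"
    using assms(1) unfolding derives_def by blast
  obtain \<Delta>' where \<Delta>': "derivation F P \<S> \<Delta>'" "hd \<Delta>' =\<^sub>s B" "last \<Delta>' =\<^sub>s C"
    using assms(2) unfolding derives_def by blast
  have last: "last \<Delta> =\<^sub>s hd \<Delta>'"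
    using \<Delta>(3) \<Delta>'(2) by (meson equ.sym equ.trans)
  obtain S \<Delta>'' where eq: "\<Delta>' = S # \<Delta>''"
    using \<Delta>'(1) unfolding derivation_def by (cases \<Delta>') auto
  \<comment> \<open>The two derivations meet only up to \<open>=\<^sub>s\<close>, so the head
    \<open>S\<close> of the second is dropped; a step absorbs equivalence at its premise and can
    therefore start from \<open>last \<Delta>\<close>.\<close>
  have "step \<S> (last \<Delta>) (hd \<Delta>'')" if "\<Delta>'' \<noteq> []"
    using \<Delta>'(1) that last unfolding derivation_def eq
    by (cases \<Delta>'') (auto simp: step_def intro: equ.trans)
  then have "derivation F P \<S> (\<Delta> @ \<Delta>'')"
    using \<Delta>(1) \<Delta>'(1) unfolding derivation_def eq
    by (auto simp: successively_append_iff successively_Cons)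
  moreover have "hd (\<Delta> @ \<Delta>'') =\<^sub>s A"
    using \<Delta>(1,2) unfolding derivation_def by simp
  moreover have "last (\<Delta> @ \<Delta>'') =\<^sub>s C"
    using \<Delta>'(3) last eq by (cases \<Delta>'') (auto intro: equ.trans)
  ultimately show ?thesis
    unfolding derives_def by blast
qed

lemma derives_mono: "derives F P \<S> A B \<Longrightarrow> \<S> \<subseteq> \<S>' \<Longrightarrow> derives F P \<S>' A B"
  unfolding derives_def derivation_def step_def
  by (elim exE conjE, intro exI conjI) (auto elim!: successively_mono)

text \<open>The second assumption expresses that the context is well-formed, with \<open>TT\<close>
  as an arbitrary well-formed filling.\<close>

lemma derives_fill:
  assumes "derives F P \<S> A B" "well_formed F P (fill C TT)"
  shows "derives F P \<S> (fill C A) (fill C B)"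
proof -
  obtain \<Delta> where \<Delta>: "derivation F P \<S> \<Delta>" "hd \<Delta> =\<^sub>s A" "last \<Delta> =\<^sub>s B"
    using assms(1) unfolding derives_def by blast
  have "well_formed F P (fill C S)" if "well_formed F P S" for S
    using well_formed_fill_cong[of F P S TT C] that assms(2) by simp
  then have "derivation F P \<S> (map (fill C) \<Delta>)"
    using \<Delta>(1) unfolding derivation_def
    by (auto simp: successively_map intro: step_fill elim: successively_mono)
  moreover have "\<Delta> \<noteq> []"
    using \<Delta>(1) unfolding derivation_def by simp
  ultimately show ?thesis
    unfolding derives_def using \<Delta>(2,3)
    by (intro exI[of _ "map (fill C) \<Delta>"]) (auto simp: hd_map last_map intro: context_closure)
qed

lemma derives_dis_cong:
  assumes "derives F P \<S> A A'" "derives F P \<S> B B'"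
  shows "derives F P \<S> (Dis [A, B]) (Dis [A', B'])"
  using derives_fill[OF assms(1), of "CDis [] Hole [B]"]
    derives_fill[OF assms(2), of "CDis [A'] Hole []"]
    derives_well_formed[OF assms(1)] derives_well_formed[OF assms(2)]
  by (auto intro: derives_trans)

lemma derives_con_cong:
  assumes "derives F P \<S> A A'" "derives F P \<S> B B'"
  shows "derives F P \<S> (Con [A, B]) (Con [A', B'])"
  using derives_fill[OF assms(1), of "CCon [] Hole [B]"]
    derives_fill[OF assms(2), of "CCon [A'] Hole []"]
    derives_well_formed[OF assms(1)] derives_well_formed[OF assms(2)]
  by (auto intro: derives_trans)

lemma derives_ex_cong: "derives F P \<S> A A' \<Longrightarrow> derives F P \<S> (Ex x A) (Ex x A')"
  using derives_fill[of F P \<S> A A' "CEx x Hole"] by simp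

lemma derives_all_cong: "derives F P \<S> A A' \<Longrightarrow> derives F P \<S> (All x A) (All x A')"
  using derives_fill[of F P \<S> A A' "CAll x Hole"] by simp

lemma derives_equ_trans:
  "derives F P \<S> A B \<Longrightarrow> B =\<^sub>s C \<Longrightarrow> derives F P \<S> A C"
  "A =\<^sub>s B \<Longrightarrow> derives F P \<S> B C \<Longrightarrow> derives F P \<S> A C"
  unfolding derives_def by (meson equ.sym equ.trans)+

declare derives_equ_trans [trans]


section \<open>Soundness in Herbrand structures\<close>

text \<open>The domain consists of all terms, ill-formed ones included, and function symbols denote
  their constructors, so that a model is given by the meaning of the predicates alone.\<close>

fun eval :: "(var \<Rightarrow> 'f trm) \<Rightarrow> 'f trm \<Rightarrow> 'f trm" where
  "eval e (Var x) = e x"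
| "eval e (Fun f ts) = Fun f (map (eval e) ts)"

fun sat :: "('p \<Rightarrow> 'f trm list \<Rightarrow> bool) \<Rightarrow> (var \<Rightarrow> 'f trm) \<Rightarrow> ('f, 'p) struc \<Rightarrow> bool" where
  "sat I e FF \<longleftrightarrow> False"
| "sat I e TT \<longleftrightarrow> True"
| "sat I e (Pred p ts) \<longleftrightarrow> I p (map (eval e) ts)"
| "sat I e (Dis Rs) \<longleftrightarrow> (\<exists>R\<in>set Rs. sat I e R)"
| "sat I e (Con Rs) \<longleftrightarrow> (\<forall>R\<in>set Rs. sat I e R)"
| "sat I e (Neg R) \<longleftrightarrow> \<not> sat I e R"
| "sat I e (Ex x R) \<longleftrightarrow> (\<exists>v. sat I (e(x := v)) R)"
| "sat I e (All x R) \<longleftrightarrow> (\<forall>v. sat I (e(x := v)) R)"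

lemma eval_cong: "(\<And>x. x \<in> vars_trm t \<Longrightarrow> e x = e' x) \<Longrightarrow> eval e t = eval e' t"
  by (induction t) auto

lemma sat_cong: "(\<And>x. x \<in> free_vars R \<Longrightarrow> e x = e' x) \<Longrightarrow> sat I e R \<longleftrightarrow> sat I e' R"
proof (induction R arbitrary: e e')
  case (Pred p ts)
  then have "map (eval e) ts = map (eval e') ts"
    by (auto intro!: eval_cong)
  then show ?case by (simp only: sat.simps)
next
  case (Ex x R)
  have "sat I (e(x := v)) R \<longleftrightarrow> sat I (e'(x := v)) R" for v
    by (rule Ex.IH) (use Ex.prems in auto)
  then show ?case by simp
next
  case (All x R)
  have "sat I (e(x := v)) R \<longleftrightarrow> sat I (e'(x := v)) R" for v
    by (rule All.IH) (use All.prems in auto)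
  then show ?case by simp
next
  case (Dis Rs)
  have "sat I e R \<longleftrightarrow> sat I e' R" if "R \<in> set Rs" for R
    by (rule Dis.IH[OF that]) (use Dis.prems that in auto)
  then show ?case by simp
next
  case (Con Rs)
  have "sat I e R \<longleftrightarrow> sat I e' R" if "R \<in> set Rs" for R
    by (rule Con.IH[OF that]) (use Con.prems that in auto)
  then show ?case by simp
next
  case (Neg R)
  have "sat I e R \<longleftrightarrow> sat I e' R"
    by (rule Neg.IH) (use Neg.prems in simp)
  then show ?case by simp
qed simp_all

lemma sat_fresh: "x \<notin> free_vars R \<Longrightarrow> sat I (e(x := v)) R \<longleftrightarrow> sat I e R"
  by (rule sat_cong) auto

lemma eval_subst_trm: "eval e (subst_trm x t s) = eval (e(x := eval e t)) s"
  by (induction s) auto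

lemma subst_trm_fresh: "x \<notin> vars_trm s \<Longrightarrow> subst_trm x t s = s"
  by (induction s) (auto intro: map_idI)

lemma subst_fresh: "x \<notin> free_vars R \<Longrightarrow> subst x t R = R"
  by (induction R) (auto intro: map_idI simp: subst_trm_fresh)

lemma sat_subst: "free_for t x R \<Longrightarrow> sat I e (subst x t R) \<longleftrightarrow> sat I (e(x := eval e t)) R"
proof (induction R arbitrary: e)
  case (Pred p ts)
  have "map (eval e) (map (subst_trm x t) ts) = map (eval (e(x := eval e t))) ts"
    by (simp add: eval_subst_trm)
  then show ?case by (simp only: sat.simps subst.simps)
next
  case (Ex y R)
  show ?case
  proof (cases "x \<in> free_vars (Ex y R)")
    case True
    then have fresh: "y \<notin> vars_trm t" "free_for t x R" "x \<noteq> y"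
      using Ex.prems by auto
    have "sat I (e(y := v)) (subst x t R) \<longleftrightarrow> sat I (e(x := eval e t, y := v)) R" for v
    proof -
      have "eval (e(y := v)) t = eval e t"
        using fresh by (auto intro: eval_cong)
      then show ?thesis
        using Ex.IH[OF fresh(2), of "e(y := v)"] fresh(3) by (metis fun_upd_twist)
    qed
    then show ?thesis using fresh(3) by (simp del: fun_upd_apply)
  next
    case False
    show ?thesis
      by (simp only: subst_fresh[OF False] sat_fresh[OF False])
  qed
next
  case (All y R)
  show ?case
  proof (cases "x \<in> free_vars (All y R)")
    case True
    then have fresh: "y \<notin> vars_trm t" "free_for t x R" "x \<noteq> y"
      using All.prems by auto
    have "sat I (e(y := v)) (subst x t R) \<longleftrightarrow> sat I (e(x := eval e t, y := v)) R" for v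
    proof -
      have "eval (e(y := v)) t = eval e t"
        using fresh by (auto intro: eval_cong)
      then show ?thesis
        using All.IH[OF fresh(2), of "e(y := v)"] fresh(3) by (metis fun_upd_twist)
    qed
    then show ?thesis using fresh(3) by (simp del: fun_upd_apply)
  next
    case False
    show ?thesis
      by (simp only: subst_fresh[OF False] sat_fresh[OF False])
  qed
qed auto

text \<open>The hole never lies under a negation, so contexts are monotone. The hypothesis ranges
  over all \<open>e\<close> because quantifiers of \<open>C\<close> rebind variables.\<close>

lemma sat_fill_mono:
  "(\<And>e. sat I e R \<Longrightarrow> sat I e T) \<Longrightarrow> sat I e (fill C R) \<Longrightarrow> sat I e (fill C T)"
  by (induction C arbitrary: e) auto

lemma sat_rename:
  assumes "y \<notin> free_vars R" "free_for (Var y) x R"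
  shows "sat I (e(y := v)) (subst x (Var y) R) \<longleftrightarrow> sat I (e(x := v)) R"
proof -
  have "sat I (e(y := v)) (subst x (Var y) R) \<longleftrightarrow> sat I (e(y := v, x := v)) R"
    using sat_subst[OF assms(2), of I "e(y := v)"] by simp
  also have "\<dots> \<longleftrightarrow> sat I (e(x := v)) R"
    using assms(1) by (intro sat_cong) auto
  finally show ?thesis .
qed

lemma sat_equ: "R =\<^sub>s T \<Longrightarrow> sat I e R \<longleftrightarrow> sat I e T"
proof (induction arbitrary: e rule: equ.induct)
  case (context_closure R T S)
  then show ?case by (meson sat_fill_mono)
qed (auto simp: sat_fresh sat_rename)

lemma sat_rule_instance: "rule_instance \<rho> A B \<Longrightarrow> sat I e A \<Longrightarrow> sat I e B"
  by (induction arbitrary: e rule: rule_instance.induct)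
    (erule sat_fill_mono[rotated]; auto simp: sat_subst)+

lemma sat_derives:
  assumes "derives F P \<S> A B" "sat I e A"
  shows "sat I e B"
proof -
  have "sat I e (last \<Delta>)" if "successively (step \<S>) \<Delta>" "\<Delta> \<noteq> []" "sat I e (hd \<Delta>)" for \<Delta> :: "('a, 'b) struc list"
    using that
  proof (induction \<Delta>)
    case (Cons A \<Delta>)
    show ?case
    proof (cases \<Delta>)
      case (Cons B \<Delta>')
      then have "step \<S> A B" using Cons.prems by simp
      then have "sat I e B"
        using Cons.prems sat_equ sat_rule_instance unfolding step_def by (metis list.sel(1))
      then show ?thesis using Cons.IH Cons.prems Cons by simp
    qed (use Cons.prems in simp)
  qed simp
  then show ?thesis
    using assms sat_equ unfolding derives_def derivation_def by metis
qed

section \<open>Negation normal forms\<close>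

text \<open>Representatives of structures modulo the equations: connectives are binary and negation
  survives only as the flag of a literal. Duality becomes a recursion, and inductions have no case
  for negation.\<close>

datatype ('f, 'p) nnf =
    Lit bool 'p "'f trm list"
  | NF | NT
  | NDis "('f, 'p) nnf" "('f, 'p) nnf"
  | NCon "('f, 'p) nnf" "('f, 'p) nnf"
  | NEx var "('f, 'p) nnf"
  | NAll var "('f, 'p) nnf"

primrec struc_of :: "('f, 'p) nnf \<Rightarrow> ('f, 'p) struc" where
  "struc_of (Lit b p ts) = (if b then Pred p ts else Neg (Pred p ts))"
| "struc_of NF = FF"
| "struc_of NT = TT"
| "struc_of (NDis A B) = Dis [struc_of A, struc_of B]"
| "struc_of (NCon A B) = Con [struc_of A, struc_of B]"
| "struc_of (NEx x A) = Ex x (struc_of A)"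
| "struc_of (NAll x A) = All x (struc_of A)"

primrec dual :: "('f, 'p) nnf \<Rightarrow> ('f, 'p) nnf" where
  "dual (Lit b p ts) = Lit (\<not> b) p ts"
| "dual NF = NT"
| "dual NT = NF"
| "dual (NDis A B) = NCon (dual A) (dual B)"
| "dual (NCon A B) = NDis (dual A) (dual B)"
| "dual (NEx x A) = NAll x (dual A)"
| "dual (NAll x A) = NEx x (dual A)"

primrec nsubst :: "var \<Rightarrow> 'f trm \<Rightarrow> ('f, 'p) nnf \<Rightarrow> ('f, 'p) nnf" where
  "nsubst x t (Lit b p ts) = Lit b p (map (subst_trm x t) ts)"
| "nsubst x t NF = NF"
| "nsubst x t NT = NT"
| "nsubst x t (NDis A B) = NDis (nsubst x t A) (nsubst x t B)"
| "nsubst x t (NCon A B) = NCon (nsubst x t A) (nsubst x t B)"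
| "nsubst x t (NEx y A) = NEx y (if y = x then A else nsubst x t A)"
| "nsubst x t (NAll y A) = NAll y (if y = x then A else nsubst x t A)"

primrec bound_vars :: "('f, 'p) nnf \<Rightarrow> var set" where
  "bound_vars (Lit b p ts) = {}"
| "bound_vars NF = {}"
| "bound_vars NT = {}"
| "bound_vars (NDis A B) = bound_vars A \<union> bound_vars B"
| "bound_vars (NCon A B) = bound_vars A \<union> bound_vars B"
| "bound_vars (NEx x A) = insert x (bound_vars A)"
| "bound_vars (NAll x A) = insert x (bound_vars A)"

abbreviation nfree :: "('f, 'p) nnf \<Rightarrow> var set" where
  "nfree A \<equiv> free_vars (struc_of A)"

abbreviation nwf :: "('f \<times> nat) set \<Rightarrow> ('p \<times> nat) set \<Rightarrow> ('f, 'p) nnf \<Rightarrow> bool" where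
  "nwf F P A \<equiv> well_formed F P (struc_of A)"

lemma struc_of_nsubst [simp]: "struc_of (nsubst x t A) = subst x t (struc_of A)"
  by (induction A) auto

lemma bound_vars_nsubst [simp]: "bound_vars (nsubst x t A) = bound_vars A"
  by (induction A) auto

lemma dual_dual [simp]: "dual (dual A) = A"
  by (induction A) auto

lemma nfree_dual [simp]: "nfree (dual A) = nfree A"
  by (induction A) auto

lemma bound_vars_dual [simp]: "bound_vars (dual A) = bound_vars A"
  by (induction A) auto

lemma nwf_dual [simp]: "nwf F P (dual A) \<longleftrightarrow> nwf F P A"
  by (induction A) auto

lemma sat_dual [simp]: "sat I e (struc_of (dual A)) \<longleftrightarrow> \<not> sat I e (struc_of A)"
  by (induction A arbitrary: e) auto

lemma is_atom_Lit [simp]: "is_atom (struc_of (Lit b p ts))"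
  by (auto intro: is_atom.intros)

lemma finite_bound_vars: "finite (bound_vars A)"
  by (induction A) auto

lemma finite_vars_trm: "finite (vars_trm t)"
  by (induction t) auto

lemma finite_nfree: "finite (nfree A)"
  by (induction A) (auto simp: finite_vars_trm)

lemma neg_struc_of: "Neg (struc_of A) =\<^sub>s struc_of (dual A)"
proof (induction A)
  case (Lit b p ts)
  then show ?case by (auto intro: equ.refl neg_neg)
next
  case (NDis A B)
  then show ?case by (auto intro: equ.trans[OF neg_dis equ_con_cong])
next
  case (NCon A B)
  then show ?case by (auto intro: equ.trans[OF neg_con equ_dis_cong])
next
  case (NEx x A)
  then show ?case by (auto intro: equ.trans[OF neg_ex equ_all_cong])
next
  case (NAll x A)
  then show ?case by (auto intro: equ.trans[OF neg_all equ_ex_cong])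
qed (auto intro: neg_FF neg_TT)

text \<open>Negations are pushed inwards and lists are bracketed to the right; the latter needs
  non-empty lists, which is what well-formedness provides.\<close>

lemma struc_of_exists:
  assumes "well_formed F P R"
  shows "\<exists>A. R =\<^sub>s struc_of A"
  using assms
proof (induction R)
  case FF
  show ?case by (rule exI[of _ NF]) (auto intro: equ.refl)
next
  case TT
  show ?case by (rule exI[of _ NT]) (auto intro: equ.refl)
next
  case (Pred p ts)
  show ?case by (rule exI[of _ "Lit True p ts"]) (auto intro: equ.refl)
next
  case (Dis Rs)
  then have "Rs \<noteq> []" "\<forall>R\<in>set Rs. \<exists>A. R =\<^sub>s struc_of A" by auto
  then show ?case
  proof (induction Rs rule: list_nonempty_induct)
    case (single R)
    then show ?case by (auto intro: equ.trans[OF equ_dis_single])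
  next
    case (cons R Rs)
    then obtain A B where "R =\<^sub>s struc_of A" "Dis Rs =\<^sub>s struc_of B" by auto
    then have "Dis (R # Rs) =\<^sub>s struc_of (NDis A B)"
      using cons.hyps by (auto intro: equ.trans[OF equ_dis_Cons equ_dis_cong])
    then show ?case ..
  qed
next
  case (Con Rs)
  then have "Rs \<noteq> []" "\<forall>R\<in>set Rs. \<exists>A. R =\<^sub>s struc_of A" by auto
  then show ?case
  proof (induction Rs rule: list_nonempty_induct)
    case (single R)
    then show ?case by (auto intro: equ.trans[OF equ_con_single])
  next
    case (cons R Rs)
    then obtain A B where "R =\<^sub>s struc_of A" "Con Rs =\<^sub>s struc_of B" by auto
    then have "Con (R # Rs) =\<^sub>s struc_of (NCon A B)"
      using cons.hyps by (auto intro: equ.trans[OF equ_con_Cons equ_con_cong])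
    then show ?case ..
  qed
next
  case (Neg R)
  then obtain A where "R =\<^sub>s struc_of A" by auto
  then show ?case using equ.trans[OF neg_closure neg_struc_of] by blast
next
  case (Ex x R)
  then obtain A where "R =\<^sub>s struc_of A" by auto
  then have "Ex x R =\<^sub>s struc_of (NEx x A)" by (auto intro: equ_ex_cong)
  then show ?case ..
next
  case (All x R)
  then obtain A where "R =\<^sub>s struc_of A" by auto
  then have "All x R =\<^sub>s struc_of (NAll x A)" by (auto intro: equ_all_cong)
  then show ?case ..
qed

text \<open>A crude sufficient condition, but a stable one: substitution leaves the bound variables
  unchanged, so confining them to a set that all substituted terms avoid keeps every substitution
  capture-free.\<close>

lemma free_for_bound_vars: "vars_trm t \<inter> bound_vars A = {} \<Longrightarrow> free_for t x (struc_of A)"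
  by (induction A) auto

lemma vars_subst_trm:
  "vars_trm (subst_trm x t s) = (vars_trm s - {x}) \<union> {z \<in> vars_trm t. x \<in> vars_trm s}"
  by (induction s) auto

lemma free_vars_subst:
  "free_for t x (struc_of A) \<Longrightarrow>
    nfree (nsubst x t A) = (nfree A - {x}) \<union> {z \<in> vars_trm t. x \<in> nfree A}"
proof (induction A)
  case (NEx y A)
  show ?case
  proof (cases "x \<in> nfree (NEx y A)")
    case True
    then show ?thesis using NEx by auto
  next
    case False
    then have "nfree (nsubst x t (NEx y A)) = nfree (NEx y A)"
      by (simp only: struc_of_nsubst subst_fresh[OF False])
    then show ?thesis using False by auto
  qed
next
  case (NAll y A)
  show ?case
  proof (cases "x \<in> nfree (NAll y A)")
    case True
    then show ?thesis using NAll by auto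
  next
    case False
    then have "nfree (nsubst x t (NAll y A)) = nfree (NAll y A)"
      by (simp only: struc_of_nsubst subst_fresh[OF False])
    then show ?thesis using False by auto
  qed
qed (auto simp: vars_subst_trm)

lemma rename_bound_vars:
  assumes "finite X"
  shows "\<exists>A'. struc_of A =\<^sub>s struc_of A' \<and> nfree A' = nfree A \<and> bound_vars A' \<inter> X = {}"
proof (induction A)
  case (Lit b p ts)
  show ?case by (rule exI[of _ "Lit b p ts"]) (auto intro: equ.refl)
next
  case NF
  show ?case by (rule exI[of _ NF]) (auto intro: equ.refl)
next
  case NT
  show ?case by (rule exI[of _ NT]) (auto intro: equ.refl)
next
  case (NDis A B)
  then obtain A' B' where "struc_of A =\<^sub>s struc_of A'" "nfree A' = nfree A" "bound_vars A' \<inter> X = {}"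
    "struc_of B =\<^sub>s struc_of B'" "nfree B' = nfree B" "bound_vars B' \<inter> X = {}" by auto
  then show ?case by (intro exI[of _ "NDis A' B'"]) (auto intro: equ_dis_cong)
next
  case (NCon A B)
  then obtain A' B' where "struc_of A =\<^sub>s struc_of A'" "nfree A' = nfree A" "bound_vars A' \<inter> X = {}"
    "struc_of B =\<^sub>s struc_of B'" "nfree B' = nfree B" "bound_vars B' \<inter> X = {}" by auto
  then show ?case by (intro exI[of _ "NCon A' B'"]) (auto intro: equ_con_cong)
next
  case (NEx x A)
  then obtain A' where A': "struc_of A =\<^sub>s struc_of A'" "nfree A' = nfree A" "bound_vars A' \<inter> X = {}"
    by auto
  have "finite (X \<union> nfree A' \<union> bound_vars A' \<union> {x})"
    using assms by (simp add: finite_nfree finite_bound_vars)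
  \<comment> \<open>Avoiding \<open>nfree A'\<close> is required by the renaming equation, avoiding
    \<open>bound_vars A'\<close> prevents capture, and avoiding \<open>X\<close> is the goal
    itself.\<close>
  then obtain y where y: "y \<notin> X \<union> nfree A' \<union> bound_vars A' \<union> {x}"
    by (metis ex_new_if_finite infinite_UNIV_nat)
  then have ff: "free_for (Var y) x (struc_of A')" by (intro free_for_bound_vars) auto
  have "struc_of (NEx x A) =\<^sub>s Ex x (struc_of A')"
    using A'(1) by (auto intro: equ_ex_cong)
  also have "\<dots> =\<^sub>s struc_of (NEx y (nsubst x (Var y) A'))"
    using rename_ex[OF _ ff] y by auto
  finally show ?case
    using y A' free_vars_subst[OF ff]
    by (intro exI[of _ "NEx y (nsubst x (Var y) A')"]) (auto split: if_splits)
next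
  case (NAll x A)
  then obtain A' where A': "struc_of A =\<^sub>s struc_of A'" "nfree A' = nfree A" "bound_vars A' \<inter> X = {}"
    by auto
  have "finite (X \<union> nfree A' \<union> bound_vars A' \<union> {x})"
    using assms by (simp add: finite_nfree finite_bound_vars)
  then obtain y where y: "y \<notin> X \<union> nfree A' \<union> bound_vars A' \<union> {x}"
    by (metis ex_new_if_finite infinite_UNIV_nat)
  then have ff: "free_for (Var y) x (struc_of A')" by (intro free_for_bound_vars) auto
  have "struc_of (NAll x A) =\<^sub>s All x (struc_of A')"
    using A'(1) by (auto intro: equ_all_cong)
  also have "\<dots> =\<^sub>s struc_of (NAll y (nsubst x (Var y) A'))"
    using rename_all[OF _ ff] y by auto
  finally show ?case
    using y A' free_vars_subst[OF ff]
    by (intro exI[of _ "NAll y (nsubst x (Var y) A')"]) (auto split: if_splits)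
qed

section \<open>A cut-free sequent calculus and its completeness\<close>

text \<open>Sequents are lists read as disjunctions. \<open>weak\<close> compares only the sets of
  members and thus covers weakening, contraction and exchange, which lets the axioms do without a
  context. The witness in \<open>ex\<close> belongs to the signature since it will occur in a
  derivation of well-formed structures.\<close>

inductive sc :: "('f \<times> nat) set \<Rightarrow> ('f, 'p) nnf list \<Rightarrow> bool" for F where
  ax: "sc F [Lit True p ts, Lit False p ts]"
| true: "sc F [NT]"
| dis: "sc F (A # B # \<Gamma>) \<Longrightarrow> sc F (NDis A B # \<Gamma>)"
| con: "sc F (A # \<Gamma>) \<Longrightarrow> sc F (B # \<Gamma>) \<Longrightarrow> sc F (NCon A B # \<Gamma>)"
| ex: "\<lbrakk>free_for t x (struc_of A); well_formed_trm F t; sc F (nsubst x t A # \<Gamma>)\<rbrakk>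
    \<Longrightarrow> sc F (NEx x A # \<Gamma>)"
| all: "\<lbrakk>free_for (Var y) x (struc_of A); y \<notin> nfree A; \<forall>B\<in>set \<Gamma>. y \<notin> nfree B;
     sc F (nsubst x (Var y) A # \<Gamma>)\<rbrakk> \<Longrightarrow> sc F (NAll x A # \<Gamma>)"
| weak: "sc F \<Gamma> \<Longrightarrow> set \<Gamma> \<subseteq> set \<Delta> \<Longrightarrow> sc F \<Delta>"

section \<open>Countably many formulas over a countable signature\<close>

instance trm :: (countable) countable
  by countable_datatype

instance nnf :: (countable, countable) countable
  by countable_datatype

lemma set_trm_well_formed: "well_formed_trm F t \<Longrightarrow> set_trm t \<subseteq> fst ` F"
proof (induction t)
  case (Fun f ts)
  then have "f \<in> fst ` F" by (auto intro: rev_image_eqI)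
  then show ?case using Fun by auto
qed simp

lemma set_nnf_well_formed:
  "nwf F P A \<Longrightarrow> set1_nnf A \<subseteq> fst ` F \<and> set2_nnf A \<subseteq> fst ` P"
proof (induction A)
  case (Lit b p ts)
  then have "\<forall>t\<in>set ts. well_formed_trm F t" "p \<in> fst ` P"
    by (auto split: if_splits intro: rev_image_eqI)
  then have "\<forall>t\<in>set ts. set_trm t \<subseteq> fst ` F" using set_trm_well_formed by blast
  then show ?case using \<open>p \<in> fst ` P\<close> by auto
qed auto

text \<open>The types of symbols may be uncountable. Numbering only the symbols in \<open>F\<close>
  and \<open>P\<close> maps the well-formed formulas injectively into formulas over natural numbers,
  which form a countable type.\<close>

lemma countable_nwf:
  fixes F :: "('f \<times> nat) set" and P :: "('p \<times> nat) set"
  assumes "countable F" "countable P"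
  shows "countable {A. nwf F P A}"
proof -
  define f where "f = to_nat_on (fst ` F)"
  define p where "p = to_nat_on (fst ` P)"
  have inj: "inj_on f (fst ` F)" "inj_on p (fst ` P)"
    unfolding f_def p_def using assms by auto
  have "inj_on (map_nnf f p) {A. nwf F P A}"
  proof (rule inj_onI, rule nnf.inj_map_strong)
    fix A B :: "('f, 'p) nnf" and g h
    assume "A \<in> {A. nwf F P A}" "B \<in> {A. nwf F P A}"
      and gh: "g \<in> set1_nnf A" "h \<in> set1_nnf B" "f g = f h"
    then have "g \<in> fst ` F" "h \<in> fst ` F"
      using set_nnf_well_formed by blast+
    then show "g = h" using inj(1) gh(3) by (auto dest: inj_onD)
  next
    fix A B :: "('f, 'p) nnf" and g h
    assume "A \<in> {A. nwf F P A}" "B \<in> {A. nwf F P A}"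
      and gh: "g \<in> set2_nnf A" "h \<in> set2_nnf B" "p g = p h"
    then have "g \<in> fst ` P" "h \<in> fst ` P"
      using set_nnf_well_formed by blast+
    then show "g = h" using inj(2) gh(3) by (auto dest: inj_onD)
  qed
  moreover have "countable (map_nnf f p ` {A. nwf F P A})"
    by (rule countableI_type)
  ultimately show ?thesis
    by (rule countable_image_inj_on[rotated])
qed

lemma well_formed_subst_trm': 
  "well_formed_trm F t \<Longrightarrow> well_formed_trm F s \<Longrightarrow> well_formed_trm F (subst_trm x t s)"
  by (induction s) auto

lemma nwf_nsubst: "nwf F P A \<Longrightarrow> well_formed_trm F t \<Longrightarrow> nwf F P (nsubst x t A)"
  by (induction A) (auto simp: well_formed_subst_trm' split: if_splits)

text \<open>The counter-model lives on all terms, but the Henkin set only speaks about well-formed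
  terms without variables from \<open>B\<close>; every other term is interpreted like such a term.\<close>

fun retract :: "('f \<times> nat) set \<Rightarrow> var set \<Rightarrow> var \<Rightarrow> 'f trm \<Rightarrow> 'f trm" where
  "retract F B y (Var x) = Var (if x \<in> B then y else x)"
| "retract F B y (Fun f ts) =
    (if (f, length ts) \<in> F then Fun f (map (retract F B y) ts) else Var y)"

lemma vars_retract: "y \<notin> B \<Longrightarrow> vars_trm (retract F B y t) \<inter> B = {}"
  by (induction t) auto

lemma well_formed_retract: "well_formed_trm F (retract F B y t)"
  by (induction t) auto

lemma retract_id: "vars_trm t \<inter> B = {} \<Longrightarrow> well_formed_trm F t \<Longrightarrow> retract F B y t = t"
proof (induction t)
  case (Fun f ts)
  then have "map (retract F B y) ts = ts" by (intro map_idI) auto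
  then show ?case using Fun.prems by simp
qed auto

text \<open>\<open>retract\<close> commutes with the symbols in \<open>F\<close>, and it is
  idempotent because its values are well-formed terms without variables from \<open>B\<close>, which
  it leaves fixed.\<close>

lemma retract_eval:
  "well_formed_trm F t \<Longrightarrow> y \<notin> B \<Longrightarrow>
    retract F B y (eval e t) = retract F B y (eval (retract F B y \<circ> e) t)"
  by (induction t) (auto simp: retract_id[OF vars_retract well_formed_retract])

text \<open>Induction measure for the truth lemma: instances of a quantified formula are not its
  subformulas, but substitution does not change this number.\<close>

primrec connectives :: "('f, 'p) nnf \<Rightarrow> nat" where
  "connectives (Lit b p ts) = 0"
| "connectives NF = 0"
| "connectives NT = 0"
| "connectives (NDis A B) = Suc (connectives A + connectives B)"
| "connectives (NCon A B) = Suc (connectives A + connectives B)"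
| "connectives (NEx x A) = Suc (connectives A)"
| "connectives (NAll x A) = Suc (connectives A)"

lemma connectives_nsubst: "connectives (nsubst x t A) = connectives A"
  by (induction A) auto

section \<open>A maximal unprovable set with witnesses\<close>

locale henkin =
  fixes F :: "('f \<times> nat) set" and P :: "('p \<times> nat) set"
    and B :: "var set" and S\<^sub>0 :: "('f, 'p) nnf"
  assumes countable_F: "countable F" and countable_P: "countable P"
    and finite_B: "finite B"
    and wf_S\<^sub>0: "nwf F P S\<^sub>0" and bound_S\<^sub>0: "bound_vars S\<^sub>0 \<subseteq> B" and free_S\<^sub>0: "nfree S\<^sub>0 \<inter> B = {}"
    and unprovable: "\<not> sc F [S\<^sub>0]"
begin

text \<open>With bound variables inside \<open>B\<close> and free ones outside, substituting a term
  without variables from \<open>B\<close> never captures. \<open>U\<close> is closed under such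
  instances of its quantified members as long as the term is well-formed.\<close>

definition U :: "('f, 'p) nnf set" where
  "U = {A. nwf F P A \<and> bound_vars A \<subseteq> B \<and> nfree A \<inter> B = {}}"

definition fresh :: "('f, 'p) nnf list \<Rightarrow> var" where
  "fresh \<Gamma> = (SOME y. y \<notin> B \<union> (\<Union>A\<in>set \<Gamma>. nfree A))"

text \<open>The collected formulas are to become false. A universal formula is false only if some
  instance is, so it enters together with an instance at a fresh variable; freshness is the side
  condition of \<open>all\<close>, by which the instance cannot make the list provable.\<close>

fun extend :: "('f, 'p) nnf \<Rightarrow> ('f, 'p) nnf list \<Rightarrow> ('f, 'p) nnf list" where
  "extend (NAll x A) \<Gamma> = (if sc F (NAll x A # \<Gamma>) then \<Gamma>
     else nsubst x (Var (fresh (NAll x A # \<Gamma>))) A # NAll x A # \<Gamma>)"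
| "extend A \<Gamma> = (if sc F (A # \<Gamma>) then \<Gamma> else A # \<Gamma>)"

primrec chain :: "nat \<Rightarrow> ('f, 'p) nnf list" where
  "chain 0 = [S\<^sub>0]"
| "chain (Suc n) = extend (from_nat_into U n) (chain n)"

definition X :: "('f, 'p) nnf set" where
  "X = (\<Union>n. set (chain n))"

lemma fresh: "fresh \<Gamma> \<notin> B" "A \<in> set \<Gamma> \<Longrightarrow> fresh \<Gamma> \<notin> nfree A"
proof -
  have "finite (B \<union> (\<Union>A\<in>set \<Gamma>. nfree A))"
    by (simp add: finite_B finite_nfree)
  then have "\<exists>y. y \<notin> B \<union> (\<Union>A\<in>set \<Gamma>. nfree A)"
    by (metis ex_new_if_finite infinite_UNIV_nat)
  then have "fresh \<Gamma> \<notin> B \<union> (\<Union>A\<in>set \<Gamma>. nfree A)"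
    unfolding fresh_def by (rule someI_ex)
  then show "fresh \<Gamma> \<notin> B" "A \<in> set \<Gamma> \<Longrightarrow> fresh \<Gamma> \<notin> nfree A" by auto
qed

lemma extend_superset: "set \<Gamma> \<subseteq> set (extend A \<Gamma>)"
  by (cases A) auto

lemma extend_mem: "\<not> sc F (A # \<Gamma>) \<Longrightarrow> A \<in> set (extend A \<Gamma>)"
  by (cases A) auto

lemma free_for_B: "bound_vars A \<subseteq> B \<Longrightarrow> vars_trm t \<inter> B = {} \<Longrightarrow> free_for t x (struc_of A)"
  by (rule free_for_bound_vars) auto

lemma U_instance:
  assumes "NEx x A \<in> U \<or> NAll x A \<in> U" "vars_trm t \<inter> B = {}" "well_formed_trm F t"
  shows "nsubst x t A \<in> U"
proof -
  have A: "bound_vars A \<subseteq> B" "nwf F P A" "(nfree A - {x}) \<inter> B = {}"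
    using assms(1) unfolding U_def by auto
  then have "free_for t x (struc_of A)" using assms(2) free_for_B by blast
  from free_vars_subst[OF this] have "nfree (nsubst x t A) \<inter> B = {}"
    using assms(2) A(3) by auto
  then show ?thesis using A assms(3) nwf_nsubst unfolding U_def by auto
qed

lemma extend_U: "A \<in> U \<Longrightarrow> set \<Gamma> \<subseteq> U \<Longrightarrow> set (extend A \<Gamma>) \<subseteq> U"
  using fresh(1) by (cases "(A, \<Gamma>)" rule: extend.cases) (auto intro: U_instance)

lemma extend_unprovable:
  assumes "A \<in> U" "\<not> sc F \<Gamma>"
  shows "\<not> sc F (extend A \<Gamma>)"
proof (cases "\<exists>x C. A = NAll x C \<and> \<not> sc F (A # \<Gamma>)")
  case True
  then obtain x C where A: "A = NAll x C" "\<not> sc F (A # \<Gamma>)" by blast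
  let ?y = "fresh (A # \<Gamma>)"
  have "x \<in> B" "bound_vars C \<subseteq> B" using assms(1) A(1) unfolding U_def by auto
  then have ff: "free_for (Var ?y) x (struc_of C)"
    using fresh(1) by (intro free_for_B) auto
  have fresh_mem: "\<forall>D\<in>set (A # \<Gamma>). ?y \<notin> nfree D"
    using fresh(2) by blast
  \<comment> \<open>Freshness for \<open>NAll x C\<close> says nothing about \<open>x\<close>
    itself; that gap is closed by \<open>x\<close> lying in \<open>B\<close> and fresh variables
    lying outside.\<close>
  moreover have "?y \<noteq> x" using fresh(1) \<open>x \<in> B\<close> by metis
  ultimately have y: "?y \<notin> nfree C" using A(1) by simp
  show ?thesis
  proof
    assume "sc F (extend A \<Gamma>)"
    then have "sc F (nsubst x (Var ?y) C # A # \<Gamma>)" using A by simp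
    \<comment> \<open>The universal formula is also part of the context, so \<open>all\<close>
      produces a second copy of it, which \<open>weak\<close> contracts.\<close>
    then have "sc F (A # A # \<Gamma>)"
      unfolding A(1) using all[OF ff y fresh_mem] A(1) by simp
    then have "sc F (A # \<Gamma>)" by (rule weak) auto
    then show False using A(2) by blast
  qed
next
  case False
  then show ?thesis using assms(2) by (cases A) auto
qed

lemma S\<^sub>0_U: "S\<^sub>0 \<in> U"
  using wf_S\<^sub>0 bound_S\<^sub>0 free_S\<^sub>0 unfolding U_def by simp

lemma from_nat_into_U: "from_nat_into U n \<in> U"
  using S\<^sub>0_U by (intro from_nat_into) auto

lemma countable_U: "countable U"
  by (rule countable_subset[OF _ countable_nwf[OF countable_F countable_P]]) (auto simp: U_def)

lemma chain_U: "set (chain n) \<subseteq> U"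
  by (induction n) (use S\<^sub>0_U extend_U[OF from_nat_into_U] in auto)

lemma chain_unprovable: "\<not> sc F (chain n)"
  by (induction n) (use unprovable extend_unprovable[OF from_nat_into_U] in auto)

lemma chain_mono: "m \<le> n \<Longrightarrow> set (chain m) \<subseteq> set (chain n)"
  by (induction n rule: dec_induct) (use extend_superset in fastforce)+

lemma X_U: "A \<in> X \<Longrightarrow> A \<in> U"
  unfolding X_def using chain_U by auto

lemma S\<^sub>0_X: "S\<^sub>0 \<in> X"
  unfolding X_def by (rule UN_I[of 0]) auto

text \<open>A sequent has finitely many members, so all of them belong to a single stage of the
  increasing chain.\<close>

lemma X_unprovable:
  assumes "set \<Gamma> \<subseteq> X"
  shows "\<not> sc F \<Gamma>"
proof -
  have "\<exists>n. set \<Gamma> \<subseteq> set (chain n)"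
    using assms
  proof (induction \<Gamma>)
    case (Cons A \<Gamma>)
    then obtain m n where "A \<in> set (chain m)" "set \<Gamma> \<subseteq> set (chain n)"
      unfolding X_def by auto
    then have "set (A # \<Gamma>) \<subseteq> set (chain (max m n))"
      using chain_mono[of m "max m n"] chain_mono[of n "max m n"] by auto
    then show ?case by blast
  qed auto
  then show ?thesis using chain_unprovable weak by blast
qed

text \<open>Each formula of \<open>U\<close> is considered at some stage and rejected only if it is
  provable together with that stage, which then serves as \<Gamma>.\<close>

lemma X_maximal:
  assumes "A \<in> U" "A \<notin> X"
  shows "\<exists>\<Gamma>. set \<Gamma> \<subseteq> X \<and> sc F (A # \<Gamma>)"
proof -
  obtain n where n: "from_nat_into U n = A"
    using from_nat_into_surj[OF countable_U assms(1)] by blast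
  have "sc F (A # chain n)"
  proof (rule ccontr)
    assume "\<not> sc F (A # chain n)"
    then have "A \<in> set (chain (Suc n))" using extend_mem n by simp
    then show False using assms(2) unfolding X_def by blast
  qed
  then show ?thesis unfolding X_def by blast
qed

lemma X_dis: "NDis A C \<in> X \<Longrightarrow> A \<in> X \<and> C \<in> X"
proof (rule ccontr)
  assume X: "NDis A C \<in> X" and "\<not> (A \<in> X \<and> C \<in> X)"
  moreover have "A \<in> U" "C \<in> U" using X_U[OF X] unfolding U_def by auto
  ultimately obtain \<Gamma> where \<Gamma>: "set \<Gamma> \<subseteq> X" "sc F (A # \<Gamma>) \<or> sc F (C # \<Gamma>)"
    using X_maximal by blast
  from \<Gamma>(2) have "sc F (A # C # \<Gamma>)" by (auto intro: weak)
  then have "sc F (NDis A C # \<Gamma>)" by (rule dis)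
  then show False using X_unprovable[of "NDis A C # \<Gamma>"] X \<Gamma>(1) by simp
qed

lemma X_con: "NCon A C \<in> X \<Longrightarrow> A \<in> X \<or> C \<in> X"
proof (rule ccontr)
  assume X: "NCon A C \<in> X" and "\<not> (A \<in> X \<or> C \<in> X)"
  moreover have "A \<in> U" "C \<in> U" using X_U[OF X] unfolding U_def by auto
  ultimately obtain \<Gamma> \<Delta> where \<Gamma>: "set \<Gamma> \<subseteq> X" "sc F (A # \<Gamma>)" "set \<Delta> \<subseteq> X" "sc F (C # \<Delta>)"
    using X_maximal by blast
  have "sc F (A # \<Gamma> @ \<Delta>)" "sc F (C # \<Gamma> @ \<Delta>)"
    by (rule weak[OF \<Gamma>(2)], force, rule weak[OF \<Gamma>(4)], force)
  then have "sc F (NCon A C # \<Gamma> @ \<Delta>)" by (rule con)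
  then show False using X_unprovable[of "NCon A C # \<Gamma> @ \<Delta>"] X \<Gamma>(1,3) by simp
qed

lemma X_ex:
  assumes X: "NEx x A \<in> X" and t: "vars_trm t \<inter> B = {}" "well_formed_trm F t"
  shows "nsubst x t A \<in> X"
proof (rule ccontr)
  assume "nsubst x t A \<notin> X"
  then obtain \<Gamma> where \<Gamma>: "set \<Gamma> \<subseteq> X" "sc F (nsubst x t A # \<Gamma>)"
    using X_maximal[OF U_instance] X_U[OF X] t by blast
  have "bound_vars A \<subseteq> B" using X_U[OF X] unfolding U_def by auto
  then have "sc F (NEx x A # \<Gamma>)"
    using t \<Gamma>(2) by (intro ex free_for_B)
  then show False using X_unprovable[of "NEx x A # \<Gamma>"] X \<Gamma>(1) by simp
qed

text \<open>The formula may have entered \<open>X\<close> at a stage other than its own in the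
  enumeration. At its own stage it cannot be rejected, since \<open>X\<close> is unprovable, and
  there its witness is added.\<close>

lemma X_all:
  assumes X: "NAll x A \<in> X"
  shows "\<exists>y. y \<notin> B \<and> nsubst x (Var y) A \<in> X"
proof -
  obtain n where n: "from_nat_into U n = NAll x A"
    using from_nat_into_surj[OF countable_U X_U[OF X]] by blast
  have "set (NAll x A # chain n) \<subseteq> X" using X unfolding X_def by auto
  then have "\<not> sc F (NAll x A # chain n)" by (rule X_unprovable)
  then have "nsubst x (Var (fresh (NAll x A # chain n))) A \<in> set (chain (Suc n))"
    using n by simp
  then show ?thesis using fresh(1) unfolding X_def by blast
qed

section \<open>The counter-model read off from the maximal set\<close>

definition r :: "'f trm \<Rightarrow> 'f trm" where
  "r = retract F B (fresh [])"

text \<open>The constant \<open>fresh []\<close> in \<open>r\<close> serves merely as some variable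
  outside \<open>B\<close>.\<close>

lemma vars_r: "vars_trm (r t) \<inter> B = {}"
  unfolding r_def using fresh(1) by (rule vars_retract)

lemma well_formed_r: "well_formed_trm F (r t)"
  unfolding r_def by (rule well_formed_retract)

lemma r_id: "vars_trm t \<inter> B = {} \<Longrightarrow> well_formed_trm F t \<Longrightarrow> r t = t"
  unfolding r_def by (rule retract_id)

lemma r_idem: "r (r t) = r t"
  by (rule r_id[OF vars_r well_formed_r])

lemma r_eval: "well_formed_trm F t \<Longrightarrow> r (eval e t) = r (eval (r \<circ> e) t)"
  unfolding r_def using fresh(1) by (rule retract_eval[rotated])

text \<open>An atom is false exactly if its positive literal belongs to \<open>X\<close>. Retracting
  the arguments makes terms of which \<open>X\<close> cannot speak behave like terms of which it
  can.\<close>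

definition I :: "'p \<Rightarrow> 'f trm list \<Rightarrow> bool" where
  "I p ts \<longleftrightarrow> Lit True p (map r ts) \<notin> X"

lemma r_upd: "r \<circ> e(x := v) = (r \<circ> e)(x := r v)"
  by auto

lemma r_comp_idem: "r \<circ> (r \<circ> e) = r \<circ> e"
  by (simp add: fun_eq_iff r_idem)

text \<open>Quantifiers range over all terms, yet truth depends on the assignment only up to
  \<open>r\<close>; so retracted terms suffice as values of quantified variables.\<close>

lemma sat_r: "nwf F P A \<Longrightarrow> sat I e (struc_of A) \<longleftrightarrow> sat I (r \<circ> e) (struc_of A)"
proof (induction A arbitrary: e)
  case (Lit b p ts)
  then have "map r (map (eval e) ts) = map r (map (eval (r \<circ> e)) ts)"
    by (auto split: if_splits intro!: r_eval)
  then have "I p (map (eval e) ts) = I p (map (eval (r \<circ> e)) ts)"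
    by (simp only: I_def)
  then show ?case by (simp del: o_apply)
next
  case (NEx x A)
  have "sat I (e(x := v)) (struc_of A) \<longleftrightarrow> sat I ((r \<circ> e)(x := v)) (struc_of A)" for v
    using NEx.IH[of "e(x := v)"] NEx.IH[of "(r \<circ> e)(x := v)"] NEx.prems
    by (simp add: r_upd r_comp_idem del: fun_upd_apply o_apply)
  then show ?case by (simp del: fun_upd_apply o_apply)
next
  case (NAll x A)
  have "sat I (e(x := v)) (struc_of A) \<longleftrightarrow> sat I ((r \<circ> e)(x := v)) (struc_of A)" for v
    using NAll.IH[of "e(x := v)"] NAll.IH[of "(r \<circ> e)(x := v)"] NAll.prems
    by (simp add: r_upd r_comp_idem del: fun_upd_apply o_apply)
  then show ?case by (simp del: fun_upd_apply o_apply)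
qed (auto simp del: o_apply)

lemma eval_Var: "eval Var t = t"
  by (induction t) (auto intro: map_idI)

text \<open>Under the assignment \<open>Var\<close> every term denotes itself, which matches the
  instances present in \<open>X\<close> with values of the quantified variable.\<close>

lemma X_false: "A \<in> X \<Longrightarrow> \<not> sat I Var (struc_of A)"
proof (induction A rule: measure_induct_rule[of connectives])
  case (less A)
  have U: "A \<in> U" using X_U less.prems by blast
  show ?case
  proof (cases A)
    case (Lit b p ts)
    have "map r ts = ts"
      using U unfolding Lit U_def by (intro map_idI r_id) (auto split: if_splits)
    moreover have "map (eval Var) ts = ts" by (intro map_idI) (rule eval_Var)
    ultimately have I: "I p (map (eval Var) ts) \<longleftrightarrow> Lit True p ts \<notin> X"
      unfolding I_def by simp
    have "\<not> (Lit True p ts \<in> X \<and> Lit False p ts \<in> X)"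
      using X_unprovable[of "[Lit True p ts, Lit False p ts]"] by (auto intro: ax)
    then show ?thesis using less.prems I Lit by (cases b) auto
  next
    case NT
    then show ?thesis using less.prems X_unprovable[of "[NT]"] by (auto intro: true)
  next
    case (NDis C D)
    then have "C \<in> X" "D \<in> X" using less.prems X_dis by blast+
    then show ?thesis using NDis less.IH[of C] less.IH[of D] by simp
  next
    case (NCon C D)
    then have "C \<in> X \<or> D \<in> X" using less.prems X_con by blast
    then show ?thesis using NCon less.IH[of C] less.IH[of D] by auto
  next
    case (NEx x C)
    have bC: "bound_vars C \<subseteq> B" "nwf F P C" using U unfolding NEx U_def by auto
    have "\<not> sat I (Var(x := v)) (struc_of C)" for v
    proof -
      have t: "vars_trm (r v) \<inter> B = {}" "well_formed_trm F (r v)"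
        by (rule vars_r well_formed_r)+
      have r: "sat I (Var(x := w)) (struc_of C) \<longleftrightarrow>
          sat I (r \<circ> Var(x := w)) (struc_of C)" for w
        using sat_r bC(2) by blast
      \<comment> \<open>\<open>X\<close> is closed only under instances at well-formed terms without
        variables from \<open>B\<close>, so the arbitrary value \<open>v\<close> is replaced by
        \<open>r v\<close>; \<open>sat_r\<close> carries falsity back to \<open>v\<close>.\<close>
      have "nsubst x (r v) C \<in> X"
        using X_ex t less.prems NEx by blast
      then have "\<not> sat I Var (subst x (r v) (struc_of C))"
        using less.IH[of "nsubst x (r v) C"] NEx by (simp add: connectives_nsubst)
      then have "\<not> sat I (Var(x := r v)) (struc_of C)"
        using sat_subst[OF free_for_B[OF bC(1) t(1)]] by (simp add: eval_Var)
      then show ?thesis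
        using r[of v] r[of "r v"] by (simp add: r_upd r_idem)
    qed
    then show ?thesis using NEx by simp
  next
    case (NAll x C)
    have bC: "bound_vars C \<subseteq> B" using U unfolding NAll U_def by auto
    obtain y where y: "y \<notin> B" "nsubst x (Var y) C \<in> X"
      using X_all less.prems NAll by blast
    then have "\<not> sat I Var (subst x (Var y) (struc_of C))"
      using less.IH[of "nsubst x (Var y) C"] NAll by (simp add: connectives_nsubst)
    then have "\<not> sat I (Var(x := Var y)) (struc_of C)"
      using sat_subst[OF free_for_B[OF bC], of "Var y"] y(1) by (simp add: eval_Var)
    then show ?thesis using NAll by auto
  qed auto
qed

end

lemma sc_complete_countable:
  assumes "countable F" "countable P" "nwf F P A" "bound_vars A \<inter> nfree A = {}"
    and valid: "\<And>I e. sat I e (struc_of A)"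
  shows "sc F [A]"
proof (rule ccontr)
  assume "\<not> sc F [A]"
  then interpret henkin F P "bound_vars A" A
    using assms by unfold_locales (auto simp: finite_bound_vars)
  show False using X_false[OF S\<^sub>0_X] valid by blast
qed

section \<open>From countable to arbitrary signatures\<close>

lemma well_formed_trm_mono: "well_formed_trm F t \<Longrightarrow> F \<subseteq> F' \<Longrightarrow> well_formed_trm F' t"
  by (induction t) auto

lemma nwf_mono: "nwf F P A \<Longrightarrow> F \<subseteq> F' \<Longrightarrow> P \<subseteq> P' \<Longrightarrow> nwf F' P' A"
  by (induction A) (auto intro: well_formed_trm_mono split: if_splits)

lemma sc_mono: "sc F \<Gamma> \<Longrightarrow> F \<subseteq> F' \<Longrightarrow> sc F' \<Gamma>"
  by (induction rule: sc.induct) (auto intro: sc.intros well_formed_trm_mono)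

lemma well_formed_trms_finite:
  assumes "\<forall>t\<in>set ts. \<exists>F'\<subseteq>F. finite F' \<and> well_formed_trm F' t"
  shows "\<exists>F'\<subseteq>F. finite F' \<and> (\<forall>t\<in>set ts. well_formed_trm F' t)"
  using assms
proof (induction ts)
  case (Cons t ts)
  then obtain F1 F2 where "F1 \<subseteq> F" "finite F1" "well_formed_trm F1 t"
    "F2 \<subseteq> F" "finite F2" "\<forall>t\<in>set ts. well_formed_trm F2 t"
    by auto
  then show ?case
    by (intro exI[of _ "F1 \<union> F2"]) (auto intro: well_formed_trm_mono)
qed (auto intro: exI[of _ "{}"])

lemma well_formed_trm_finite:
  "well_formed_trm F t \<Longrightarrow> \<exists>F'\<subseteq>F. finite F' \<and> well_formed_trm F' t"
proof (induction t)
  case (Fun f ts)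
  then obtain F' where "F' \<subseteq> F" "finite F'" "\<forall>t\<in>set ts. well_formed_trm F' t"
    using well_formed_trms_finite[of ts F] by auto
  then show ?case
    using Fun.prems
    by (intro exI[of _ "insert (f, length ts) F'"]) (auto intro: well_formed_trm_mono)
qed auto

lemma nwf_finite:
  "nwf F P A \<Longrightarrow> \<exists>F'\<subseteq>F. \<exists>P'\<subseteq>P. finite F' \<and> finite P' \<and> nwf F' P' A"
proof (induction A)
  case (Lit b p ts)
  then obtain F' where "F' \<subseteq> F" "finite F'" "\<forall>t\<in>set ts. well_formed_trm F' t"
    using well_formed_trms_finite[of ts F] well_formed_trm_finite[of F] by (auto split: if_splits)
  then show ?case
    using Lit by (intro exI[of _ F'] exI[of _ "{(p, length ts)}"] conjI) (auto split: if_splits)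
next
  case (NDis A B)
  then obtain F1 P1 F2 P2 where "F1 \<subseteq> F" "P1 \<subseteq> P" "finite F1" "finite P1" "nwf F1 P1 A"
    "F2 \<subseteq> F" "P2 \<subseteq> P" "finite F2" "finite P2" "nwf F2 P2 B"
    by auto
  then show ?case
    by (intro exI[of _ "F1 \<union> F2"] exI[of _ "P1 \<union> P2"] conjI) (auto intro: nwf_mono)
next
  case (NCon A B)
  then obtain F1 P1 F2 P2 where "F1 \<subseteq> F" "P1 \<subseteq> P" "finite F1" "finite P1" "nwf F1 P1 A"
    "F2 \<subseteq> F" "P2 \<subseteq> P" "finite F2" "finite P2" "nwf F2 P2 B"
    by auto
  then show ?case
    by (intro exI[of _ "F1 \<union> F2"] exI[of _ "P1 \<union> P2"] conjI) (auto intro: nwf_mono)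
qed auto

text \<open>Validity does not refer to the signature, so the latter can be shrunk to the finitely
  many symbols of \<open>A\<close>; a sequent proof over the smaller signature is also one over
  \<open>F\<close>.\<close>

theorem sc_complete:
  assumes "nwf F P A" "bound_vars A \<inter> nfree A = {}" "\<And>I e. sat I e (struc_of A)"
  shows "sc F [A]"
proof -
  obtain F' P' where "F' \<subseteq> F" "P' \<subseteq> P" "finite F'" "finite P'" "nwf F' P' A"
    using nwf_finite[OF assms(1)] by blast
  then have "sc F' [A]"
    using assms(2,3) by (intro sc_complete_countable) (auto intro: countable_finite)
  then show ?thesis using \<open>F' \<subseteq> F\<close> by (rule sc_mono)
qed

section \<open>Expansions\<close>

text \<open>Atomic weakening and contraction, in either order, lead from an expansion of a formula to
  the formula.\<close>

inductive expand :: "('f, 'p) nnf \<Rightarrow> ('f, 'p) nnf \<Rightarrow> bool" where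
  Lit: "expand (Lit b p ts) (Lit b p ts)"
| weaken: "expand NF (Lit b p ts)"
| contract: "expand A (Lit b p ts) \<Longrightarrow> expand B (Lit b p ts) \<Longrightarrow> expand (NDis A B) (Lit b p ts)"
| NF: "expand NF NF"
| NT: "expand NT NT"
| NDis: "expand A' A \<Longrightarrow> expand B' B \<Longrightarrow> expand (NDis A' B') (NDis A B)"
| NCon: "expand A' A \<Longrightarrow> expand B' B \<Longrightarrow> expand (NCon A' B') (NCon A B)"
| NEx: "expand A' A \<Longrightarrow> expand (NEx x A') (NEx x A)"
| NAll: "expand A' A \<Longrightarrow> expand (NAll x A') (NAll x A)"

inductive_cases expand_NFE: "expand A' NF"
inductive_cases expand_NTE: "expand A' NT"
inductive_cases expand_NDisE: "expand A' (NDis A B)"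
inductive_cases expand_NConE: "expand A' (NCon A B)"
inductive_cases expand_NExE: "expand A' (NEx x A)"
inductive_cases expand_NAllE: "expand A' (NAll x A)"

lemmas expand_elims = expand_NFE expand_NTE expand_NDisE expand_NConE expand_NExE expand_NAllE

lemma nwf_expand: "expand A' A \<Longrightarrow> nwf F P A \<Longrightarrow> nwf F P A'"
  by (induction rule: expand.induct) auto

text \<open>Only an inclusion, since a literal turned into \<open>NF\<close> loses its variables;
  this is the direction in which eigenvariable and capture conditions pass to expansions.\<close>

lemma nfree_expand: "expand A' A \<Longrightarrow> nfree A' \<subseteq> nfree A"
  by (induction rule: expand.induct) auto

lemma free_for_expand:
  "expand A' A \<Longrightarrow> free_for t x (struc_of A) \<Longrightarrow> free_for t x (struc_of A')"
proof (induction rule: expand.induct)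
  case (NEx A' A y)
  then show ?case using nfree_expand[OF NEx.hyps] by auto
next
  case (NAll A' A y)
  then show ?case using nfree_expand[OF NAll.hyps] by auto
qed auto

lemma expand_nsubst_Lit:
  "expand A'' L \<Longrightarrow> L = nsubst x t (Lit b p ts) \<Longrightarrow>
    \<exists>A'. expand A' (Lit b p ts) \<and> A'' = nsubst x t A'"
proof (induction rule: expand.induct)
  case Lit
  then show ?case by (intro exI[of _ "Lit b p ts"]) (auto intro: expand.Lit)
next
  case weaken
  then show ?case by (intro exI[of _ NF]) (auto intro: expand.weaken)
next
  case (contract A _ _ _ B)
  then obtain A' B' where "expand A' (Lit b p ts)" "A = nsubst x t A'"
      "expand B' (Lit b p ts)" "B = nsubst x t B'" by blast
  then show ?case by (intro exI[of _ "NDis A' B'"]) (auto intro: expand.contract)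
qed auto

text \<open>The premise of a quantifier rule contains an instance, its conclusion the uninstantiated
  formula, so an expansion of the one must be lifted to an expansion of the other. Every copy of a
  literal lifts on its own.\<close>

lemma expand_nsubst:
  "expand A'' (nsubst x t A) \<Longrightarrow> \<exists>A'. expand A' A \<and> A'' = nsubst x t A'"
proof (induction A arbitrary: A'')
  case (Lit b p ts)
  from expand_nsubst_Lit[OF this HOL.refl] show ?case .
next
  case NF
  then show ?case by (intro exI[of _ NF]) (auto elim!: expand_elims intro!: expand.NF)
next
  case NT
  then show ?case by (intro exI[of _ NT]) (auto elim!: expand_elims intro!: expand.NT)
next
  case (NDis A B)
  from NDis.prems obtain C D where "A'' = NDis C D" "expand C (nsubst x t A)" "expand D (nsubst x t B)"
    by (auto elim!: expand_elims)
  moreover obtain A' B' where "expand A' A" "C = nsubst x t A'" "expand B' B" "D = nsubst x t B'"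
    using NDis.IH calculation by metis
  ultimately show ?case by (intro exI[of _ "NDis A' B'"]) (auto intro: expand.intros)
next
  case (NCon A B)
  from NCon.prems obtain C D where "A'' = NCon C D" "expand C (nsubst x t A)" "expand D (nsubst x t B)"
    by (auto elim!: expand_elims)
  moreover obtain A' B' where "expand A' A" "C = nsubst x t A'" "expand B' B" "D = nsubst x t B'"
    using NCon.IH calculation by metis
  ultimately show ?case by (intro exI[of _ "NCon A' B'"]) (auto intro: expand.intros)
next
  case (NEx y A)
  from NEx.prems obtain C where C: "A'' = NEx y C" "expand C (if y = x then A else nsubst x t A)"
    by (auto elim!: expand_elims)
  show ?case
  proof (cases "y = x")
    case True
    then show ?thesis using C by (intro exI[of _ "NEx y C"]) (auto intro: expand.intros)
  next
    case False
    then obtain A' where "expand A' A" "C = nsubst x t A'" using NEx.IH C by auto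
    then show ?thesis using C False by (intro exI[of _ "NEx y A'"]) (auto intro: expand.intros)
  qed
next
  case (NAll y A)
  from NAll.prems obtain C where C: "A'' = NAll y C" "expand C (if y = x then A else nsubst x t A)"
    by (auto elim!: expand_elims)
  show ?case
  proof (cases "y = x")
    case True
    then show ?thesis using C by (intro exI[of _ "NAll y C"]) (auto intro: expand.intros)
  next
    case False
    then obtain A' where "expand A' A" "C = nsubst x t A'" using NAll.IH C by auto
    then show ?thesis using C False by (intro exI[of _ "NAll y A'"]) (auto intro: expand.intros)
  qed
qed

primrec blank :: "('f, 'p) nnf \<Rightarrow> ('f, 'p) nnf" where
  "blank (Lit b p ts) = NF"
| "blank NF = NF"
| "blank NT = NT"
| "blank (NDis A B) = NDis (blank A) (blank B)"
| "blank (NCon A B) = NCon (blank A) (blank B)"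
| "blank (NEx x A) = NEx x (blank A)"
| "blank (NAll x A) = NAll x (blank A)"

lemma expand_blank: "expand (blank A) A"
  by (induction A) (auto intro: expand.intros)

text \<open>Each connective applied to units is evaluated by a unit equation, and every quantifier
  over a unit is vacuous.\<close>

lemma blank_equ: "\<exists>u\<in>{FF, TT}. struc_of (blank A) =\<^sub>s u"
proof (induction A)
  case (NDis A B)
  then obtain u v where uv: "u \<in> {FF, TT}" "struc_of (blank A) =\<^sub>s u"
      "v \<in> {FF, TT}" "struc_of (blank B) =\<^sub>s v" by blast
  have "\<exists>w\<in>{FF, TT}. Dis [u, v] =\<^sub>s w"
    using uv(1,3) dis_FF dis_TT equ_dis_FF_right by fast
  then show ?case using equ.trans[OF equ_dis_cong[OF uv(2,4)]] by auto
next
  case (NCon A B)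
  then obtain u v where uv: "u \<in> {FF, TT}" "struc_of (blank A) =\<^sub>s u"
      "v \<in> {FF, TT}" "struc_of (blank B) =\<^sub>s v" by blast
  have "\<exists>w\<in>{FF, TT}. Con [u, v] =\<^sub>s w"
    using uv(1,3) con_FF con_TT equ_con_TT_right by fast
  then show ?case using equ.trans[OF equ_con_cong[OF uv(2,4)]] by auto
next
  case (NEx x A)
  then obtain u where u: "u \<in> {FF, TT}" "struc_of (blank A) =\<^sub>s u" by blast
  then have "Ex x u =\<^sub>s u" by (auto intro!: vacuous_ex)
  then show ?case using equ.trans[OF equ_ex_cong[OF u(2)]] u(1) by auto
next
  case (NAll x A)
  then obtain u where u: "u \<in> {FF, TT}" "struc_of (blank A) =\<^sub>s u" by blast
  then have "All x u =\<^sub>s u" by (auto intro!: vacuous_all)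
  then show ?case using equ.trans[OF equ_all_cong[OF u(2)]] u(1) by auto
qed (auto intro: equ.refl)


section \<open>Derivations without contraction and weakening\<close>

context
  fixes F :: "('f \<times> nat) set" and P :: "('p \<times> nat) set"
begin

abbreviation (input) wfs :: "('f, 'p) struc \<Rightarrow> bool" where
  "wfs \<equiv> well_formed F P"

abbreviation (input) der :: "rule set \<Rightarrow> ('f, 'p) struc \<Rightarrow> ('f, 'p) struc \<Rightarrow> bool" where
  "der \<equiv> derives F P"

lemma derives_refl: "wfs A \<Longrightarrow> der \<S> A A"
  by (rule derives_equ) (auto intro: equ.refl)

lemmas derives_dis_left = derives_dis_cong[OF _ derives_refl]
lemmas derives_dis_right = derives_dis_cong[OF derives_refl]
lemmas derives_con_left = derives_con_cong[OF _ derives_refl]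
lemmas derives_con_right = derives_con_cong[OF derives_refl]

lemma derives_switch:
  "\<lbrakk>switch \<in> \<S>; wfs R; wfs T; wfs U\<rbrakk> \<Longrightarrow> der \<S> (Con [Dis [R, U], T]) (Dis [Con [R, T], U])"
  using rule_instance.intros(7)[of Hole] by (intro derives_rule[of switch]) auto

lemma derives_medial:
  "\<lbrakk>medial \<in> \<S>; wfs R; wfs T; wfs U; wfs V\<rbrakk> \<Longrightarrow>
    der \<S> (Dis [Con [R, U], Con [T, V]]) (Con [Dis [R, T], Dis [U, V]])"
  using rule_instance.intros(8)[of Hole] by (intro derives_rule[of medial]) auto

lemma derives_u_down:
  "\<lbrakk>u_down \<in> \<S>; wfs R; wfs T\<rbrakk> \<Longrightarrow> der \<S> (All x (Dis [R, T])) (Dis [All x R, Ex x T])"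
  using rule_instance.intros(9)[of Hole] by (intro derives_rule[of u_down]) auto

lemma derives_u_up:
  "\<lbrakk>u_up \<in> \<S>; wfs R; wfs T\<rbrakk> \<Longrightarrow> der \<S> (Con [Ex x R, All x T]) (Ex x (Con [R, T]))"
  using rule_instance.intros(10)[of Hole] by (intro derives_rule[of u_up]) auto

lemma derives_n_down:
  "\<lbrakk>n_down \<in> \<S>; free_for t x R; wfs (subst x t R); wfs R\<rbrakk> \<Longrightarrow> der \<S> (subst x t R) (Ex x R)"
  using rule_instance.intros(11)[of t x R Hole] by (intro derives_rule[of n_down]) auto

lemma derives_l1_down:
  "\<lbrakk>l1_down \<in> \<S>; wfs R; wfs T\<rbrakk> \<Longrightarrow> der \<S> (Dis [Ex x R, Ex x T]) (Ex x (Dis [R, T]))"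
  using rule_instance.intros(13)[of Hole] by (intro derives_rule[of l1_down]) auto

lemma derives_l2_down:
  "\<lbrakk>l2_down \<in> \<S>; wfs R; wfs T\<rbrakk> \<Longrightarrow> der \<S> (Dis [All x R, All x T]) (All x (Dis [R, T]))"
  using rule_instance.intros(15)[of Hole] by (intro derives_rule[of l2_down]) auto

text \<open>Doubling \<open>TT\<close> gives switch something to move: \<open>([TT, TT], FF)\<close>
  becomes \<open>[(TT, FF), TT]\<close>, which collapses to \<open>TT\<close>.\<close>

lemma derives_FF_TT:
  assumes "switch \<in> \<S>"
  shows "der \<S> FF TT"
proof -
  have "FF =\<^sub>s Con [TT, FF]" by (rule equ.sym[OF con_TT])
  also have "\<dots> =\<^sub>s Con [Dis [TT, TT], FF]"
    by (intro equ_con_cong equ.refl equ.sym[OF dis_TT])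
  also have "der \<S> \<dots> (Dis [Con [TT, FF], TT])"
    by (intro derives_switch assms) auto
  also have "\<dots> =\<^sub>s Dis [FF, TT]"
    by (intro equ_dis_cong equ.refl con_TT)
  also have "\<dots> =\<^sub>s TT" by (rule dis_FF)
  finally show ?thesis .
qed

lemma derives_blank:
  assumes "switch \<in> \<S>"
  shows "der \<S> FF (struc_of (blank A))"
  using blank_equ[of A] derives_FF_TT[OF assms] derives_refl[of FF]
  by (auto intro: derives_equ_trans(1) equ.sym)

text \<open>What is left of \<open>KSq\<close> without its three atomic rules.\<close>

definition KQ :: "rule set" where
  "KQ = {switch, medial, u_down, l1_down, l2_down, n_down}"

lemma KQ_mem [simp]:
  "switch \<in> KQ" "medial \<in> KQ" "u_down \<in> KQ" "l1_down \<in> KQ" "l2_down \<in> KQ" "n_down \<in> KQ"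
  unfolding KQ_def by auto

text \<open>Contraction of an arbitrary formula with the atomic part postponed: each connective has
  a rule or an equation that brings the two copies of its arguments together, and at a literal the
  constructor \<open>contract\<close> joins the two expansions without any rule.\<close>

lemma merge_expansions:
  "\<lbrakk>nwf F P A; expand B A; expand C A\<rbrakk> \<Longrightarrow>
    \<exists>D. expand D A \<and> der KQ (Dis [struc_of B, struc_of C]) (struc_of D)"
proof (induction A arbitrary: B C)
  case (Lit b p ts)
  then have "nwf F P (NDis B C)" by (auto dest: nwf_expand)
  then show ?case
    using Lit by (intro exI[of _ "NDis B C"]) (auto intro: expand.contract derives_refl)
next
  case NF
  then have "B = NF" "C = NF" by (auto elim!: expand_elims)
  then show ?case by (intro exI[of _ NF]) (auto intro: expand.intros derives_equ dis_FF)
next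
  case NT
  then have "B = NT" "C = NT" by (auto elim!: expand_elims)
  then show ?case by (intro exI[of _ NT]) (auto intro: expand.intros derives_equ dis_TT)
next
  case (NDis A1 A2)
  obtain B1 B2 where B: "B = NDis B1 B2" "expand B1 A1" "expand B2 A2"
    using NDis.prems by (auto elim!: expand_elims)
  obtain C1 C2 where C: "C = NDis C1 C2" "expand C1 A1" "expand C2 A2"
    using NDis.prems by (auto elim!: expand_elims)
  obtain D1 D2 where D: "expand D1 A1" "der KQ (Dis [struc_of B1, struc_of C1]) (struc_of D1)"
    "expand D2 A2" "der KQ (Dis [struc_of B2, struc_of C2]) (struc_of D2)"
    using NDis.IH(1)[OF _ B(2) C(2)] NDis.IH(2)[OF _ B(3) C(3)] NDis.prems(1) by auto
  have "Dis [struc_of B, struc_of C] =\<^sub>s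
      Dis [Dis [struc_of B1, struc_of C1], Dis [struc_of B2, struc_of C2]]"
    unfolding B C by (auto intro: equ_dis_swap)
  also have "der KQ \<dots> (struc_of (NDis D1 D2))"
    using D by (auto intro: derives_dis_cong)
  finally show ?case using D by (auto intro: expand.intros)
next
  case (NCon A1 A2)
  obtain B1 B2 where B: "B = NCon B1 B2" "expand B1 A1" "expand B2 A2"
    using NCon.prems by (auto elim!: expand_elims)
  obtain C1 C2 where C: "C = NCon C1 C2" "expand C1 A1" "expand C2 A2"
    using NCon.prems by (auto elim!: expand_elims)
  have wf: "nwf F P B1" "nwf F P B2" "nwf F P C1" "nwf F P C2"
    using NCon.prems(1) B C by (auto intro: nwf_expand)
  obtain D1 D2 where D: "expand D1 A1" "der KQ (Dis [struc_of B1, struc_of C1]) (struc_of D1)"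
    "expand D2 A2" "der KQ (Dis [struc_of B2, struc_of C2]) (struc_of D2)"
    using NCon.IH(1)[OF _ B(2) C(2)] NCon.IH(2)[OF _ B(3) C(3)] NCon.prems(1) by auto
  have "der KQ (Dis [struc_of B, struc_of C])
      (Con [Dis [struc_of B1, struc_of C1], Dis [struc_of B2, struc_of C2]])"
    unfolding B C using wf by (auto intro: derives_medial)
  also have "der KQ \<dots> (struc_of (NCon D1 D2))"
    using D by (auto intro: derives_con_cong)
  finally show ?case using D by (auto intro: expand.intros)
next
  case (NEx x A)
  obtain B1 where B: "B = NEx x B1" "expand B1 A"
    using NEx.prems by (auto elim!: expand_elims)
  obtain C1 where C: "C = NEx x C1" "expand C1 A"
    using NEx.prems by (auto elim!: expand_elims)
  have wf: "nwf F P B1" "nwf F P C1"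
    using NEx.prems(1) B C by (auto intro: nwf_expand)
  obtain D where D: "expand D A" "der KQ (Dis [struc_of B1, struc_of C1]) (struc_of D)"
    using NEx.IH[OF _ B(2) C(2)] NEx.prems(1) by auto
  have "der KQ (Dis [struc_of B, struc_of C]) (Ex x (Dis [struc_of B1, struc_of C1]))"
    unfolding B C using wf by (auto intro: derives_l1_down)
  also have "der KQ \<dots> (struc_of (NEx x D))"
    using D by (auto intro: derives_ex_cong)
  finally show ?case using D by (auto intro: expand.intros)
next
  case (NAll x A)
  obtain B1 where B: "B = NAll x B1" "expand B1 A"
    using NAll.prems by (auto elim!: expand_elims)
  obtain C1 where C: "C = NAll x C1" "expand C1 A"
    using NAll.prems by (auto elim!: expand_elims)
  have wf: "nwf F P B1" "nwf F P C1"
    using NAll.prems(1) B C by (auto intro: nwf_expand)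
  obtain D where D: "expand D A" "der KQ (Dis [struc_of B1, struc_of C1]) (struc_of D)"
    using NAll.IH[OF _ B(2) C(2)] NAll.prems(1) by auto
  have "der KQ (Dis [struc_of B, struc_of C]) (All x (Dis [struc_of B1, struc_of C1]))"
    unfolding B C using wf by (auto intro: derives_l2_down)
  also have "der KQ \<dots> (struc_of (NAll x D))"
    using D by (auto intro: derives_all_cong)
  finally show ?case using D by (auto intro: expand.intros)
qed

section \<open>Translation of sequent proofs into derivations\<close>

definition provable :: "('f, 'p) struc \<Rightarrow> bool" where
  "provable A \<longleftrightarrow> (\<exists>Y. der {ai_down} TT Y \<and> der KQ Y A)"

lemma provable_well_formed: "provable A \<Longrightarrow> wfs A"
  unfolding provable_def using derives_well_formed by blast

lemma provable_derives: "provable A \<Longrightarrow> der KQ A B \<Longrightarrow> provable B"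
  unfolding provable_def using derives_trans by blast

lemma provable_equ: "provable A \<Longrightarrow> A =\<^sub>s B \<Longrightarrow> provable B"
  using provable_derives derives_equ provable_well_formed by blast

lemma provable_TT: "provable TT"
  unfolding provable_def using derives_refl[of TT] by auto

text \<open>\<open>TT\<close> is split into two conjuncts, and the interaction phases of both proofs
  run side by side before either second phase starts, so the order of phases is kept.\<close>

lemma provable_con:
  assumes "provable A" "provable B"
  shows "provable (Con [A, B])"
proof -
  obtain Y Z where YZ: "der {ai_down} TT Y" "der KQ Y A" "der {ai_down} TT Z" "der KQ Z B"
    using assms unfolding provable_def by blast
  have "TT =\<^sub>s Con [TT, TT]" by (rule equ.sym[OF con_TT])
  also have "der {ai_down} \<dots> (Con [Y, Z])" using YZ by (intro derives_con_cong)
  finally show ?thesis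
    unfolding provable_def using YZ derives_con_cong by blast
qed

lemma provable_all:
  assumes "provable A"
  shows "provable (All x A)"
proof -
  obtain Y where Y: "der {ai_down} TT Y" "der KQ Y A"
    using assms unfolding provable_def by blast
  have "TT =\<^sub>s All x TT" by (rule equ.sym[OF vacuous_all]) auto
  also have "der {ai_down} \<dots> (All x Y)" using Y by (intro derives_all_cong)
  finally show ?thesis
    unfolding provable_def using Y derives_all_cong by blast
qed

lemma provable_axiom:
  assumes "is_atom a" "wfs a"
  shows "provable (Dis [a, Neg a])"
proof -
  have "der {ai_down} TT (Dis [a, Neg a])"
    using rule_instance.intros(1)[OF assms(1), of Hole] assms(2)
    by (intro derives_rule[of ai_down]) auto
  then show ?thesis
    unfolding provable_def using derives_refl[of "Dis [a, Neg a]"] assms(2) by auto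
qed

text \<open>The final \<open>NF\<close> covers the empty sequent and gives all other sequents the
  same shape; it disappears by the unit equation.\<close>

primrec ndisj :: "('f, 'p) nnf list \<Rightarrow> ('f, 'p) nnf" where
  "ndisj [] = NF"
| "ndisj (A # \<Gamma>) = NDis A (ndisj \<Gamma>)"

lemma nwf_ndisj: "nwf F P (ndisj \<Gamma>) \<longleftrightarrow> (\<forall>A\<in>set \<Gamma>. nwf F P A)"
  by (induction \<Gamma>) auto

lemma nfree_ndisj: "nfree (ndisj \<Gamma>) = (\<Union>A\<in>set \<Gamma>. nfree A)"
  by (induction \<Gamma>) auto

text \<open>All positions other than the chosen occurrence are filled with blanks, which
  \<open>FF\<close> derives.\<close>

lemma weaken_member:
  assumes "A \<in> set \<Delta>" "expand A' A" "nwf F P (ndisj \<Delta>)"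
  shows "\<exists>G. expand G (ndisj \<Delta>) \<and> der KQ (struc_of A') (struc_of G)"
  using assms
proof (induction \<Delta>)
  case (Cons B \<Delta>)
  show ?case
  proof (cases "A = B")
    case True
    have "nwf F P A'" using Cons.prems True by (auto intro: nwf_expand)
    have "struc_of A' =\<^sub>s Dis [struc_of A', FF]" by (rule equ.sym[OF equ_dis_FF_right])
    also have "der KQ \<dots> (struc_of (NDis A' (blank (ndisj \<Delta>))))"
      unfolding struc_of.simps
      by (intro derives_dis_right derives_blank KQ_mem \<open>nwf F P A'\<close>)
    finally show ?thesis
      using True Cons.prems
      by (intro exI[of _ "NDis A' (blank (ndisj \<Delta>))"]) (auto intro: expand.intros expand_blank)
  next
    case False
    then obtain G where G: "expand G (ndisj \<Delta>)" "der KQ (struc_of A') (struc_of G)"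
      using Cons by auto
    note G(2)
    also have "struc_of G =\<^sub>s Dis [FF, struc_of G]" by (rule equ.sym[OF dis_FF])
    also have "der KQ \<dots> (struc_of (NDis (blank B) G))"
      unfolding struc_of.simps
      by (intro derives_dis_left derives_blank KQ_mem derives_well_formed(2)[OF G(2)])
    finally show ?thesis
      using G(1)
      by (intro exI[of _ "NDis (blank B) G"]) (auto intro: expand.intros expand_blank)
  qed
qed simp

text \<open>Each member of \<Gamma> gets an expansion of all of \<Delta> to itself, and these are
  merged. Merging thereby also contracts members that occur repeatedly.\<close>

lemma weaken_sequent:
  assumes "set \<Gamma> \<subseteq> set \<Delta>" "expand G (ndisj \<Gamma>)" "nwf F P (ndisj \<Delta>)"
  shows "\<exists>H. expand H (ndisj \<Delta>) \<and> der KQ (struc_of G) (struc_of H)"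
  using assms
proof (induction \<Gamma> arbitrary: G)
  case Nil
  then have "G = NF" by (auto elim!: expand_elims)
  then show ?case
    by (intro exI[of _ "blank (ndisj \<Delta>)"]) (auto intro: expand_blank derives_blank)
next
  case (Cons A \<Gamma>)
  obtain A' G' where G: "G = NDis A' G'" "expand A' A" "expand G' (ndisj \<Gamma>)"
    using Cons.prems by (auto elim!: expand_elims)
  obtain H1 where H1: "expand H1 (ndisj \<Delta>)" "der KQ (struc_of A') (struc_of H1)"
    using weaken_member[of A \<Delta> A'] G Cons.prems by auto
  obtain H2 where H2: "expand H2 (ndisj \<Delta>)" "der KQ (struc_of G') (struc_of H2)"
    using Cons.IH G Cons.prems by auto
  obtain H where H: "expand H (ndisj \<Delta>)" "der KQ (Dis [struc_of H1, struc_of H2]) (struc_of H)"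
    using merge_expansions[OF Cons.prems(3) H1(1) H2(1)] by blast
  have "der KQ (struc_of G) (Dis [struc_of H1, struc_of H2])"
    unfolding G using H1 H2 by (auto intro: derives_dis_cong)
  then show ?case using H derives_trans by blast
qed

text \<open>One switch for each conjunct moves its context out; afterwards the contexts stand side
  by side, ready to be merged.\<close>

lemma derives_switch_contexts:
  assumes "switch \<in> \<S>" "wfs A" "wfs B" "wfs G" "wfs H"
  shows "der \<S> (Con [Dis [A, G], Dis [B, H]]) (Dis [Con [A, B], Dis [G, H]])"
proof -
  have "der \<S> (Con [Dis [A, G], Dis [B, H]]) (Dis [Con [A, Dis [B, H]], G])"
    using assms by (intro derives_switch) auto
  also have "\<dots> =\<^sub>s Dis [Con [Dis [B, H], A], G]"
    by (intro equ_dis_cong equ.refl con_comm)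
  also have "der \<S> \<dots> (Dis [Dis [Con [B, A], H], G])"
    using assms by (intro derives_dis_left derives_switch) auto
  also have "\<dots> =\<^sub>s Dis [Con [B, A], Dis [H, G]]" by (rule equ_dis_assoc)
  also have "\<dots> =\<^sub>s Dis [Con [A, B], Dis [G, H]]"
    by (intro equ_dis_cong con_comm dis_comm)
  finally show ?thesis .
qed

lemma sc_provable:
  "sc F \<Gamma> \<Longrightarrow> \<forall>A\<in>set \<Gamma>. nwf F P A \<Longrightarrow>
    \<exists>G. expand G (ndisj \<Gamma>) \<and> provable (struc_of G)"
proof (induction rule: sc.induct)
  case (ax p ts)
  then have "wfs (Pred p ts)" by auto
  then have "provable (Dis [Pred p ts, Neg (Pred p ts)])"
    by (intro provable_axiom) (auto intro: is_atom.intros)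
  then have "provable (struc_of (ndisj [Lit True p ts, Lit False p ts]))"
    by (rule provable_equ) (auto intro!: equ_dis_cong equ.refl equ.sym[OF equ_dis_FF_right])
  then show ?case by (intro exI[of _ "ndisj [Lit True p ts, Lit False p ts]"]) (auto intro: expand.intros)
next
  case true
  have "provable (struc_of (ndisj [NT]))"
    by (rule provable_equ[OF provable_TT]) (auto intro!: equ.sym[OF equ_dis_FF_right])
  then show ?case by (intro exI[of _ "ndisj [NT]"]) (auto intro: expand.intros)
next
  case (dis A B \<Gamma>)
  then obtain G where "expand G (ndisj (A # B # \<Gamma>))" "provable (struc_of G)" by auto
  moreover then obtain A' B' G' where G: "G = NDis A' (NDis B' G')"
    "expand A' A" "expand B' B" "expand G' (ndisj \<Gamma>)"
    by (auto elim!: expand_elims)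
  ultimately have "provable (struc_of (NDis (NDis A' B') G'))"
    by (auto intro: provable_equ equ.sym[OF equ_dis_assoc])
  then show ?case using G by (intro exI[of _ "NDis (NDis A' B') G'"]) (auto intro: expand.intros)
next
  case (con A \<Gamma> B)
  then obtain G1 G2 where "expand G1 (ndisj (A # \<Gamma>))" "provable (struc_of G1)"
     "expand G2 (ndisj (B # \<Gamma>))" "provable (struc_of G2)" by auto
  moreover then obtain A' B' G H where G: "G1 = NDis A' G" "G2 = NDis B' H"
    "expand A' A" "expand B' B" "expand G (ndisj \<Gamma>)" "expand H (ndisj \<Gamma>)"
    by (auto elim!: expand_elims)
  ultimately have prov: "provable (Con [Dis [struc_of A', struc_of G], Dis [struc_of B', struc_of H]])"
    by (auto intro: provable_con)
  have wf: "nwf F P A'" "nwf F P B'" "nwf F P G" "nwf F P H"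
    using provable_well_formed[OF prov] by auto
  \<comment> \<open>The two premises yield different expansions of the same context \<Gamma>;
    merging replaces them by one.\<close>
  obtain K where K: "expand K (ndisj \<Gamma>)" "der KQ (Dis [struc_of G, struc_of H]) (struc_of K)"
    using merge_expansions[OF _ G(5,6)] con.prems nwf_ndisj by auto
  have "der KQ (Con [Dis [struc_of A', struc_of G], Dis [struc_of B', struc_of H]])
      (Dis [Con [struc_of A', struc_of B'], Dis [struc_of G, struc_of H]])"
    using wf by (intro derives_switch_contexts) auto
  also have "der KQ \<dots> (struc_of (NDis (NCon A' B') K))"
    using wf K(2) by (auto intro: derives_dis_right)
  finally have "provable (struc_of (NDis (NCon A' B') K))"
    using prov provable_derives by blast
  then show ?case using G K by (intro exI[of _ "NDis (NCon A' B') K"]) (auto intro: expand.intros)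
next
  case (ex t x A \<Gamma>)
  have wfA: "nwf F P A" using ex.prems by auto
  have "nwf F P (nsubst x t A)"
    by (rule nwf_nsubst[OF wfA ex.hyps(2)])
  then obtain G where "expand G (ndisj (nsubst x t A # \<Gamma>))" "provable (struc_of G)"
    using ex by auto
  moreover then obtain A'' G' where G: "G = NDis A'' G'"
    "expand A'' (nsubst x t A)" "expand G' (ndisj \<Gamma>)"
    by (auto elim!: expand_elims)
  moreover obtain A' where A': "expand A' A" "A'' = nsubst x t A'"
    using expand_nsubst[OF G(2)] by blast
  ultimately have prov: "provable (Dis [subst x t (struc_of A'), struc_of G'])" by simp
  have "der KQ (Dis [subst x t (struc_of A'), struc_of G']) (struc_of (NDis (NEx x A') G'))"
    using provable_well_formed[OF prov] free_for_expand[OF A'(1) ex.hyps(1)]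
      nwf_expand[OF A'(1) wfA]
    unfolding struc_of.simps by (intro derives_dis_left derives_n_down) auto
  then have "provable (struc_of (NDis (NEx x A') G'))"
    using prov provable_derives by blast
  then show ?case using G A' by (intro exI[of _ "NDis (NEx x A') G'"]) (auto intro: expand.intros)
next
  case (all y x A \<Gamma>)
  have wfA: "nwf F P A" using all.prems by auto
  have "nwf F P (nsubst x (Var y) A)"
    by (rule nwf_nsubst[OF wfA]) simp
  then obtain G where "expand G (ndisj (nsubst x (Var y) A # \<Gamma>))" "provable (struc_of G)"
    using all by auto
  moreover then obtain A'' G' where G: "G = NDis A'' G'"
    "expand A'' (nsubst x (Var y) A)" "expand G' (ndisj \<Gamma>)"
    by (auto elim!: expand_elims)
  moreover obtain A' where A': "expand A' A" "A'' = nsubst x (Var y) A'"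
    using expand_nsubst[OF G(2)] by blast
  ultimately have prov: "provable (All y (Dis [subst x (Var y) (struc_of A'), struc_of G']))"
    using provable_all by simp
  have fresh: "y \<notin> nfree G'" "y \<notin> nfree A'"
    using nfree_expand[OF G(3)] nfree_expand[OF A'(1)] all.hyps by (auto simp: nfree_ndisj)
  \<comment> \<open>\<open>u_down\<close> distributes the quantifier over the eigenvariable. The
    existential quantifier that falls to the context is vacuous, and renaming \<open>y\<close> back
    to \<open>x\<close> restores the principal formula.\<close>
  have "der KQ (All y (Dis [subst x (Var y) (struc_of A'), struc_of G']))
      (Dis [All y (subst x (Var y) (struc_of A')), Ex y (struc_of G')])"
    using provable_well_formed[OF prov] by (intro derives_u_down) auto
  also have "\<dots> =\<^sub>s struc_of (NDis (NAll x A') G')"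
    using fresh free_for_expand[OF A'(1) all.hyps(1)]
    by (auto intro!: equ_dis_cong equ.sym[OF rename_all] vacuous_ex)
  finally have "provable (struc_of (NDis (NAll x A') G'))"
    using prov provable_derives by blast
  then show ?case using G A' by (intro exI[of _ "NDis (NAll x A') G'"]) (auto intro: expand.intros)
next
  case (weak \<Gamma> \<Delta>)
  then obtain G where G: "expand G (ndisj \<Gamma>)" "provable (struc_of G)" by auto
  obtain H where "expand H (ndisj \<Delta>)" "der KQ (struc_of G) (struc_of H)"
    using weaken_sequent[OF weak.hyps(2) G(1)] weak.prems nwf_ndisj by auto
  then show ?case using G provable_derives by blast
qed

section \<open>Undoing expansions and eliminating cuts\<close>

definition derives2 :: "rule set \<Rightarrow> rule set \<Rightarrow> ('f, 'p) struc \<Rightarrow> ('f, 'p) struc \<Rightarrow> bool" where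
  "derives2 \<S> \<S>' A B \<longleftrightarrow> (\<exists>X. der \<S> A X \<and> der \<S>' X B)"

lemma derives2_fst: "der \<S> A B \<Longrightarrow> derives2 \<S> \<S>' A B"
  unfolding derives2_def using derives_refl derives_well_formed(2) by blast

lemma derives2_snd: "der \<S>' A B \<Longrightarrow> derives2 \<S> \<S>' A B"
  unfolding derives2_def using derives_refl derives_well_formed(1) by blast

lemma derives2_refl: "wfs A \<Longrightarrow> derives2 \<S> \<S>' A A"
  by (rule derives2_fst[OF derives_refl])

lemma derives2_trans_fst [trans]: "der \<S> A B \<Longrightarrow> derives2 \<S> \<S>' B C \<Longrightarrow> derives2 \<S> \<S>' A C"
  unfolding derives2_def using derives_trans by blast

lemma derives2_trans_snd [trans]: "derives2 \<S> \<S>' A B \<Longrightarrow> der \<S>' B C \<Longrightarrow> derives2 \<S> \<S>' A C"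
  unfolding derives2_def using derives_trans by blast

text \<open>The components are independent, so both first phases can be run before both second
  phases.\<close>

lemma derives2_dis_cong:
  "derives2 \<S> \<S>' A A' \<Longrightarrow> derives2 \<S> \<S>' B B' \<Longrightarrow> derives2 \<S> \<S>' (Dis [A, B]) (Dis [A', B'])"
  unfolding derives2_def using derives_dis_cong by blast

lemma derives2_con_cong:
  "derives2 \<S> \<S>' A A' \<Longrightarrow> derives2 \<S> \<S>' B B' \<Longrightarrow> derives2 \<S> \<S>' (Con [A, B]) (Con [A', B'])"
  unfolding derives2_def using derives_con_cong by blast

lemma derives2_ex_cong: "derives2 \<S> \<S>' A A' \<Longrightarrow> derives2 \<S> \<S>' (Ex x A) (Ex x A')"
  unfolding derives2_def using derives_ex_cong by blast

lemma derives2_all_cong: "derives2 \<S> \<S>' A A' \<Longrightarrow> derives2 \<S> \<S>' (All x A) (All x A')"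
  unfolding derives2_def using derives_all_cong by blast

lemmas derives2_cong = derives2_dis_cong derives2_con_cong derives2_ex_cong derives2_all_cong

lemma derives2_mono:
  "derives2 \<S> \<S>' A B \<Longrightarrow> \<S> \<subseteq> \<T> \<Longrightarrow> \<S>' \<subseteq> \<T> \<Longrightarrow> der \<T> A B"
  unfolding derives2_def
  by (elim exE conjE) (rule derives_trans[OF derives_mono derives_mono])

section \<open>Undoing expansions by atomic contraction and weakening\<close>

lemma derives_aw_down: "is_atom a \<Longrightarrow> wfs a \<Longrightarrow> der {aw_down} FF a"
  using rule_instance.intros(3)[of a Hole] by (intro derives_rule[of aw_down]) auto

lemma derives_aw_up: "is_atom a \<Longrightarrow> wfs a \<Longrightarrow> der {aw_up} a TT"
  using rule_instance.intros(4)[of a Hole] by (intro derives_rule[of aw_up]) auto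

lemma derives_ac_down: "is_atom a \<Longrightarrow> wfs a \<Longrightarrow> der {ac_down} (Dis [a, a]) a"
  using rule_instance.intros(5)[of a Hole] by (intro derives_rule[of ac_down]) auto

lemma derives_ac_up: "is_atom a \<Longrightarrow> wfs a \<Longrightarrow> der {ac_up} a (Con [a, a])"
  using rule_instance.intros(6)[of a Hole] by (intro derives_rule[of ac_up]) auto

lemma derives_ai_up: "is_atom a \<Longrightarrow> wfs a \<Longrightarrow> der {ai_up} (Con [a, Neg a]) FF"
  using rule_instance.intros(2)[of a Hole] by (intro derives_rule[of ai_up]) auto

text \<open>In the expansion of a literal all leaves \<open>NF\<close> are weakened to the literal,
  after which only equal copies have to be contracted.\<close>

lemma expand_weaken_contract:
  "expand A' A \<Longrightarrow> nwf F P A \<Longrightarrow> derives2 {aw_down} {ac_down} (struc_of A') (struc_of A)"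
proof (induction rule: expand.induct)
  case (Lit b p ts)
  then show ?case by (intro derives2_refl)
next
  case (weaken b p ts)
  then have "der {aw_down} FF (struc_of (Lit b p ts))"
    by (intro derives_aw_down is_atom_Lit)
  then show ?case by (auto intro: derives2_fst)
next
  case (contract A b p ts B)
  let ?L = "struc_of (Lit b p ts)"
  have "derives2 {aw_down} {ac_down} (struc_of (NDis A B)) (Dis [?L, ?L])"
    using contract unfolding struc_of.simps(4) by (intro derives2_dis_cong)
  also have "der {ac_down} \<dots> ?L"
    using contract.prems by (intro derives_ac_down is_atom_Lit)
  finally show ?case .
qed (auto intro: derives2_cong derives2_refl)

text \<open>Prepares the order in which contraction comes first: leaves \<open>NF\<close> disappear
  by unit equations and copies are contracted, so one literal remains, or \<open>FF\<close> if there
  was no copy at all.\<close>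

lemma expand_contract_Lit:
  "expand A' L \<Longrightarrow> L = Lit b p ts \<Longrightarrow> nwf F P L \<Longrightarrow>
    der {ac_down} (struc_of A') FF \<or> der {ac_down} (struc_of A') (struc_of L)"
proof (induction rule: expand.induct)
  case (Lit b p ts)
  then show ?case using derives_refl by blast
next
  case (weaken b p ts)
  then show ?case using derives_refl[of FF] by auto
next
  case (contract A b p ts B)
  let ?L = "struc_of (Lit b p ts)"
  have wf: "wfs ?L" using contract.prems by (auto split: if_splits)
  obtain u v where uv: "u \<in> {FF, ?L}" "der {ac_down} (struc_of A) u"
      "v \<in> {FF, ?L}" "der {ac_down} (struc_of B) v"
    using contract by blast
  have "der {ac_down} (Dis [?L, ?L]) ?L"
    using wf by (intro derives_ac_down is_atom_Lit)
  moreover have "der {ac_down} (Dis [FF, w]) w" "der {ac_down} (Dis [w, FF]) w" if "wfs w" for w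
    using that by (auto intro: derives_equ dis_FF equ_dis_FF_right)
  ultimately have "\<exists>w\<in>{FF, ?L}. der {ac_down} (Dis [u, v]) w"
    using uv(1,3) wf well_formed.simps(1) by (elim insertE emptyE; hypsubst; blast)
  moreover have "der {ac_down} (struc_of (NDis A B)) (Dis [u, v])"
    using uv(2,4) by (auto intro: derives_dis_cong)
  ultimately show ?case using derives_trans by blast
qed auto

lemma expand_contract_weaken:
  "expand A' A \<Longrightarrow> nwf F P A \<Longrightarrow> derives2 {ac_down} {aw_down} (struc_of A') (struc_of A)"
proof (induction rule: expand.induct)
  case (Lit b p ts)
  then show ?case by (intro derives2_refl)
next
  case (weaken b p ts)
  then have "der {aw_down} FF (struc_of (Lit b p ts))"
    by (intro derives_aw_down is_atom_Lit)
  then show ?case by (auto intro: derives2_snd)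
next
  case (contract A b p ts B)
  let ?L = "struc_of (Lit b p ts)"
  have "expand (NDis A B) (Lit b p ts)"
    using contract.hyps by (rule expand.contract)
  then have "der {ac_down} (struc_of (NDis A B)) FF \<or> der {ac_down} (struc_of (NDis A B)) ?L"
    using contract.prems by (rule expand_contract_Lit[OF _ HOL.refl])
  moreover have "der {aw_down} FF ?L"
    using contract.prems by (intro derives_aw_down is_atom_Lit)
  ultimately show ?case
    using derives2_fst unfolding derives2_def by blast
qed (auto intro: derives2_cong derives2_refl)

text \<open>Duality exchanges premise and conclusion and turns down rules into up rules, so the two
  phases also change their order: this mirrors weakening followed by contraction.\<close>

lemma expand_dual_contract_weaken:
  "expand A' A \<Longrightarrow> nwf F P A \<Longrightarrow>
    derives2 {ac_up} {aw_up} (struc_of (dual A)) (struc_of (dual A'))"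
proof (induction rule: expand.induct)
  case (Lit b p ts)
  then show ?case by (intro derives2_refl) (auto split: if_splits)
next
  case (weaken b p ts)
  then have "der {aw_up} (struc_of (Lit (\<not> b) p ts)) TT"
    by (intro derives_aw_up is_atom_Lit) (auto split: if_splits)
  then show ?case unfolding dual.simps struc_of.simps(3) by (rule derives2_snd)
next
  case (contract A b p ts B)
  let ?L = "struc_of (dual (Lit b p ts))"
  have "der {ac_up} ?L (Con [?L, ?L])"
    unfolding dual.simps using contract.prems by (intro derives_ac_up is_atom_Lit) (auto split: if_splits)
  also have "derives2 {ac_up} {aw_up} \<dots> (struc_of (dual (NDis A B)))"
    using contract unfolding dual.simps(4) struc_of.simps(5) by (intro derives2_con_cong)
  finally show ?case .
qed (auto intro: derives2_cong derives2_refl)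

lemma expand_dual_contract_Lit:
  "expand A' L \<Longrightarrow> L = Lit b p ts \<Longrightarrow> nwf F P L \<Longrightarrow>
    der {ac_up} TT (struc_of (dual A')) \<or> der {ac_up} (struc_of (dual L)) (struc_of (dual A'))"
proof (induction rule: expand.induct)
  case (Lit b p ts)
  then show ?case using derives_refl nwf_dual by blast
next
  case (weaken b p ts)
  then show ?case using derives_refl[of TT] by auto
next
  case (contract A b p ts B)
  let ?L = "struc_of (dual (Lit b p ts))"
  have wf: "wfs ?L" using contract.prems by (auto split: if_splits)
  obtain u v where uv: "u \<in> {TT, ?L}" "der {ac_up} u (struc_of (dual A))"
      "v \<in> {TT, ?L}" "der {ac_up} v (struc_of (dual B))"
    using contract by blast
  have "der {ac_up} ?L (Con [?L, ?L])"
    unfolding dual.simps using wf by (intro derives_ac_up is_atom_Lit) (auto split: if_splits)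
  moreover have "der {ac_up} w (Con [TT, w])" "der {ac_up} w (Con [w, TT])" if "wfs w" for w
    using that by (auto intro: derives_equ equ.sym[OF con_TT] equ.sym[OF equ_con_TT_right])
  ultimately have "\<exists>w\<in>{TT, ?L}. der {ac_up} w (Con [u, v])"
    using uv(1,3) wf well_formed.simps(2) by (elim insertE emptyE; hypsubst; blast)
  moreover have "der {ac_up} (Con [u, v]) (struc_of (dual (NDis A B)))"
    using uv(2,4) by (auto intro: derives_con_cong)
  ultimately show ?case using derives_trans by blast
qed auto

lemma expand_dual_weaken_contract:
  "expand A' A \<Longrightarrow> nwf F P A \<Longrightarrow>
    derives2 {aw_up} {ac_up} (struc_of (dual A)) (struc_of (dual A'))"
proof (induction rule: expand.induct)
  case (Lit b p ts)
  then show ?case by (intro derives2_refl) (auto split: if_splits)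
next
  case (weaken b p ts)
  then have "der {aw_up} (struc_of (Lit (\<not> b) p ts)) TT"
    by (intro derives_aw_up is_atom_Lit) (auto split: if_splits)
  then show ?case unfolding dual.simps struc_of.simps(3) by (rule derives2_fst)
next
  case (contract A b p ts B)
  let ?L = "struc_of (dual (Lit b p ts))"
  have "expand (NDis A B) (Lit b p ts)"
    using contract.hyps by (rule expand.contract)
  then have "der {ac_up} TT (struc_of (dual (NDis A B))) \<or>
      der {ac_up} ?L (struc_of (dual (NDis A B)))"
    using contract.prems by (rule expand_dual_contract_Lit[OF _ HOL.refl])
  moreover have "der {aw_up} ?L TT"
    unfolding dual.simps using contract.prems by (intro derives_aw_up is_atom_Lit) (auto split: if_splits)
  ultimately show ?case
    using derives2_snd unfolding derives2_def by blast
qed (auto intro: derives2_cong derives2_refl)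

section \<open>Reduction of a cut to atomic cuts\<close>

lemma derives_switch_pair:
  assumes "switch \<in> \<S>" "wfs A" "wfs B" "wfs A'" "wfs B'"
  shows "der \<S> (Con [Con [A', B'], Dis [A, B]]) (Dis [Con [A', A], Con [B', B]])"
proof -
  have "Con [Con [A', B'], Dis [A, B]] =\<^sub>s Con [Dis [A, B], Con [A', B']]"
    by (rule con_comm)
  also have "\<dots> =\<^sub>s Con [Con [Dis [A, B], A'], B']"
    by (rule equ.sym[OF equ_con_assoc])
  also have "der \<S> \<dots> (Con [Dis [Con [A, A'], B], B'])"
    using assms by (intro derives_con_left derives_switch) auto
  also have "\<dots> =\<^sub>s Con [Dis [B, Con [A, A']], B']"
    by (intro equ_con_cong equ.refl dis_comm)
  also have "der \<S> \<dots> (Dis [Con [B, B'], Con [A, A']])"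
    using assms by (intro derives_switch) auto
  also have "\<dots> =\<^sub>s Dis [Con [A, A'], Con [B, B']]"
    by (rule dis_comm)
  also have "\<dots> =\<^sub>s Dis [Con [A', A], Con [B', B]]"
    by (intro equ_dis_cong con_comm)
  finally show ?thesis .
qed

text \<open>Disjunctions against conjunctions are split by switch, dual quantifiers by
  \<open>u_up\<close>; neither needs an atomic cut to have been made before. The cases
  \<open>NCon\<close> and \<open>NEx\<close> exchange the two conjuncts to meet the fixed order
  expected by the splitting rules.\<close>

lemma derives_cut:
  "nwf F P A \<Longrightarrow> derives2 {switch, u_up} {ai_up} (Con [struc_of (dual A), struc_of A]) FF"
proof (induction A)
  case (Lit b p ts)
  let ?p = "Pred p ts"
  have "der {ai_up} (Con [?p, Neg ?p]) FF"
    using Lit by (intro derives_ai_up is_atom.intros) (auto split: if_splits)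
  then have "der {ai_up} (Con [struc_of (dual (Lit b p ts)), struc_of (Lit b p ts)]) FF"
    using con_comm by (cases b) (auto intro: derives_equ_trans(2))
  then show ?case by (rule derives2_snd)
next
  case NF
  show ?case by (auto intro!: derives2_fst derives_equ con_TT)
next
  case NT
  show ?case by (auto intro!: derives2_fst derives_equ equ_con_TT_right)
next
  case (NDis A B)
  have "der {switch, u_up} (Con [struc_of (dual (NDis A B)), struc_of (NDis A B)])
      (Dis [Con [struc_of (dual A), struc_of A], Con [struc_of (dual B), struc_of B]])"
    unfolding dual.simps struc_of.simps
    using NDis.prems by (intro derives_switch_pair) auto
  also have "derives2 {switch, u_up} {ai_up} \<dots> (Dis [FF, FF])"
    using NDis by (intro derives2_dis_cong) auto
  also have "der {ai_up} \<dots> FF"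
    by (intro derives_equ dis_FF) auto
  finally show ?case .
next
  case (NCon A B)
  have "Con [struc_of (dual (NCon A B)), struc_of (NCon A B)] =\<^sub>s
      Con [struc_of (NCon A B), struc_of (dual (NCon A B))]"
    by (rule con_comm)
  also have "der {switch, u_up} \<dots>
      (Dis [Con [struc_of A, struc_of (dual A)], Con [struc_of B, struc_of (dual B)]])"
    unfolding dual.simps struc_of.simps
    using NCon.prems by (intro derives_switch_pair) auto
  also have "\<dots> =\<^sub>s Dis [Con [struc_of (dual A), struc_of A], Con [struc_of (dual B), struc_of B]]"
    by (intro equ_dis_cong con_comm)
  also have "derives2 {switch, u_up} {ai_up} \<dots> (Dis [FF, FF])"
    using NCon by (intro derives2_dis_cong) auto
  also have "der {ai_up} \<dots> FF"
    by (intro derives_equ dis_FF) auto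
  finally show ?case .
next
  case (NEx x A)
  have "Con [struc_of (dual (NEx x A)), struc_of (NEx x A)] =\<^sub>s
      Con [Ex x (struc_of A), All x (struc_of (dual A))]"
    by (auto intro: con_comm)
  also have "der {switch, u_up} \<dots> (Ex x (Con [struc_of A, struc_of (dual A)]))"
    using NEx.prems by (intro derives_u_up) auto
  also have "\<dots> =\<^sub>s Ex x (Con [struc_of (dual A), struc_of A])"
    by (intro equ_ex_cong con_comm)
  also have "derives2 {switch, u_up} {ai_up} \<dots> (Ex x FF)"
    using NEx by (intro derives2_ex_cong) auto
  also have "der {ai_up} \<dots> FF"
    by (auto intro!: derives_equ vacuous_ex)
  finally show ?case .
next
  case (NAll x A)
  have "der {switch, u_up} (Con [struc_of (dual (NAll x A)), struc_of (NAll x A)])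
      (Ex x (Con [struc_of (dual A), struc_of A]))"
    using NAll.prems by (auto intro: derives_u_up)
  also have "derives2 {switch, u_up} {ai_up} \<dots> (Ex x FF)"
    using NAll by (intro derives2_ex_cong) auto
  also have "der {ai_up} \<dots> FF"
    by (auto intro!: derives_equ vacuous_ex)
  finally show ?case .
qed

end

section \<open>Decomposition\<close>

lemma valid_expansion_provable:
  assumes "nwf F P A" "bound_vars A \<inter> nfree A = {}" "\<And>I e. sat I e (struc_of A)"
  shows "\<exists>B. expand B A \<and> provable F P (struc_of B)"
proof -
  obtain G where G: "expand G (ndisj [A])" "provable F P (struc_of G)"
    using sc_provable[OF sc_complete[OF assms]] assms(1) by auto
  then obtain B where B: "G = NDis B NF" "expand B A"
    by (auto elim!: expand_elims)
  then have "provable F P (struc_of B)"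
    using G(2) by (auto intro: provable_equ equ_dis_FF_right)
  then show ?thesis using B(2) by blast
qed

text \<open>The common source of all statements about \<open>SKSq\<close>. \<open>Y\<close> arises
  from \<open>TT\<close> and \<open>K\<close> reduces to \<open>FF\<close>, so the interaction
  phases are tied neither to \<open>T\<close> nor to \<open>R\<close> and can be placed anywhere.
  Both orders of contraction and weakening are offered for the same \<open>M\<close> and
  \<open>N\<close>.\<close>

lemma derivation_decomposition:
  fixes F :: "('f \<times> nat) set" and P :: "('p \<times> nat) set"
  assumes "derives F P \<S> T R"
  shows "\<exists>M N K Y.
    derives2 F P {ac_up} {aw_up} T M \<and> derives2 F P {aw_up} {ac_up} T M \<and>
    derives F P {ai_down} TT Y \<and> derives F P (insert u_up KQ) (Con [M, Y]) (Dis [K, N]) \<and>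
    derives F P {ai_up} K FF \<and>
    derives2 F P {aw_down} {ac_down} N R \<and> derives2 F P {ac_down} {aw_down} N R"
proof -
  let ?Q = "insert u_up KQ"
  note wf_TR = derives_well_formed[OF assms]
  obtain A0 C0 where 0: "T =\<^sub>s struc_of A0" "R =\<^sub>s struc_of C0"
    using wf_TR struc_of_exists by blast
  \<comment> \<open>Each formula must avoid the free variables of both, since completeness is
    applied to their disjunction.\<close>
  let ?X = "nfree A0 \<union> nfree C0"
  have "finite ?X" by (simp add: finite_nfree)
  then obtain A C where
    A: "struc_of A0 =\<^sub>s struc_of A" "nfree A = nfree A0" "bound_vars A \<inter> ?X = {}" and
    C: "struc_of C0 =\<^sub>s struc_of C" "nfree C = nfree C0" "bound_vars C \<inter> ?X = {}"
    using rename_bound_vars by metis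
  have T: "T =\<^sub>s struc_of A" and R: "R =\<^sub>s struc_of C"
    using 0 A(1) C(1) by (auto intro: equ.trans)
  have wf: "nwf F P (dual A)" "nwf F P C"
    using equ_well_formed[OF T] equ_well_formed[OF R] wf_TR by auto
  have "sat I e (struc_of (NDis (dual A) C))" for I e
    using sat_derives[OF assms, of I e] sat_equ[OF T, of I e] sat_equ[OF R, of I e] by auto
  moreover have "bound_vars (NDis (dual A) C) \<inter> nfree (NDis (dual A) C) = {}"
    using A C by auto
  ultimately obtain B where B: "expand B (NDis (dual A) C)" "provable F P (struc_of B)"
    using valid_expansion_provable[of F P "NDis (dual A) C"] wf by auto
  then obtain D E where D: "B = NDis D E" "expand D (dual A)" "expand E C"
    by (auto elim!: expand_elims)
  let ?M = "struc_of (dual D)" and ?D = "struc_of D" and ?N = "struc_of E"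
  obtain Y where Y: "derives F P {ai_down} TT Y" "derives F P KQ Y (Dis [?D, ?N])"
    using B(2) D(1) unfolding provable_def by auto
  have wfD: "well_formed F P ?M" "well_formed F P ?D" "well_formed F P ?N"
    using nwf_expand[OF D(2) wf(1)] nwf_expand[OF D(3) wf(2)] by auto
  \<comment> \<open>The cut is carried out only up to the point \<open>K\<close> where nothing but
    atomic cuts remains.\<close>
  obtain K where K: "derives F P {switch, u_up} (Con [?M, ?D]) K" "derives F P {ai_up} K FF"
    using derives_cut[OF wfD(2)] unfolding derives2_def by blast
  have "derives F P ?Q (Con [?M, Y]) (Con [?M, Dis [?D, ?N]])"
    using Y(2) wfD(1) by (intro derives_con_right) (auto elim: derives_mono)
  also have "\<dots> =\<^sub>s Con [Dis [?D, ?N], ?M]" by (rule con_comm)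
  also have "derives F P ?Q \<dots> (Dis [Con [?D, ?M], ?N])"
    using wfD by (intro derives_switch) auto
  also have "\<dots> =\<^sub>s Dis [Con [?M, ?D], ?N]"
    by (intro equ_dis_cong equ.refl con_comm)
  also have "derives F P ?Q \<dots> (Dis [K, ?N])"
    using K(1) wfD(3) by (intro derives_dis_left) (auto elim: derives_mono)
  finally have Q: "derives F P ?Q (Con [?M, Y]) (Dis [K, ?N])" .
  have "derives F P {ac_up} T (struc_of A)" "derives F P {aw_up} T (struc_of A)"
    "derives F P {ac_down} (struc_of C) R" "derives F P {aw_down} (struc_of C) R"
    using T R wf_TR wf by (auto intro: derives_equ equ.sym)
  then have "derives2 F P {ac_up} {aw_up} T ?M" "derives2 F P {aw_up} {ac_up} T ?M"
    "derives2 F P {aw_down} {ac_down} ?N R" "derives2 F P {ac_down} {aw_down} ?N R"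
    using expand_dual_contract_weaken[OF D(2) wf(1)] expand_dual_weaken_contract[OF D(2) wf(1)]
      expand_weaken_contract[OF D(3) wf(2)] expand_contract_weaken[OF D(3) wf(2)]
    unfolding dual_dual by (blast intro: derives2_trans_fst derives2_trans_snd)+
  then show ?thesis using Y(1) Q K(2) by blast
qed

text \<open>With premise \<open>TT\<close> the conclusion itself is valid, so there is nothing to
  cut against and all rules used are down rules.\<close>

lemma proof_decomposition:
  fixes F :: "('f \<times> nat) set" and P :: "('p \<times> nat) set"
  assumes "derives F P \<S> TT R"
  shows "\<exists>N. provable F P N \<and>
    derives2 F P {aw_down} {ac_down} N R \<and> derives2 F P {ac_down} {aw_down} N R"
proof -
  note wf_R = derives_well_formed(2)[OF assms]
  obtain C0 where "R =\<^sub>s struc_of C0"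
    using wf_R struc_of_exists by blast
  moreover obtain C where C: "struc_of C0 =\<^sub>s struc_of C" "nfree C = nfree C0"
      "bound_vars C \<inter> nfree C0 = {}"
    using rename_bound_vars[OF finite_nfree] by metis
  ultimately have R: "R =\<^sub>s struc_of C" by (auto intro: equ.trans)
  then have wf: "nwf F P C" using equ_well_formed wf_R by blast
  have "sat I e (struc_of C)" for I e
    using sat_derives[OF assms, of I e] sat_equ[OF R, of I e] by auto
  then obtain E where E: "expand E C" "provable F P (struc_of E)"
    using valid_expansion_provable[of F P C] wf C by auto
  have "derives F P {ac_down} (struc_of C) R" "derives F P {aw_down} (struc_of C) R"
    using R wf by (auto intro: derives_equ equ.sym)
  then have "derives2 F P {aw_down} {ac_down} (struc_of E) R"
    "derives2 F P {ac_down} {aw_down} (struc_of E) R"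
    using expand_weaken_contract[OF E(1) wf] expand_contract_weaken[OF E(1) wf]
    by (blast intro: derives2_trans_snd)+
  then show ?thesis using E(2) by blast
qed

text \<open>The unit equation makes room for \<open>Y\<close> next to any structure; this is what
  allows interactions to be introduced at a chosen place.\<close>

lemma derives_insert_premise:
  assumes "derives F P \<S> TT Y" "well_formed F P A"
  shows "derives F P \<S> A (Con [A, Y])"
proof -
  have "A =\<^sub>s Con [A, TT]" by (rule equ.sym[OF equ_con_TT_right])
  also have "derives F P \<S> \<dots> (Con [A, Y])" using assms by (intro derives_con_right)
  finally show ?thesis .
qed

lemma derives_delete_conclusion:
  assumes "derives F P \<S> K FF" "well_formed F P A"
  shows "derives F P \<S> (Dis [K, A]) A"
proof -
  have "derives F P \<S> (Dis [K, A]) (Dis [FF, A])" using assms by (intro derives_dis_left)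
  also have "\<dots> =\<^sub>s A" by (rule dis_FF)
  finally show ?thesis .
qed

theorem theorem4p18:
  fixes F :: "('f \<times> nat) set" and P :: "('p \<times> nat) set"
  shows
    "(\<forall>T R. derives F P SKSq T R \<longrightarrow>
        (\<exists>V U. derives F P {ai_down} T V \<and>
               derives F P (SKSq - {ai_down, ai_up}) V U \<and>
               derives F P {ai_up} U R)) \<and>
     (\<forall>S. derives F P KSq TT S \<longrightarrow>
        (\<exists>S'. derives F P (KSq - {ac_down}) TT S' \<and>
              derives F P {ac_down} S' S)) \<and>
     (\<forall>T R. derives F P SKSq T R \<longrightarrow>
        (\<exists>V U. derives F P {ac_up} T V \<and>
               derives F P (SKSq - {ac_down, ac_up}) V U \<and>
               derives F P {ac_down} U R)) \<and>
     (\<forall>S. derives F P KSq TT S \<longrightarrow>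
        (\<exists>S'. derives F P (KSq - {aw_down}) TT S' \<and>
              derives F P {aw_down} S' S)) \<and>
     (\<forall>T R. derives F P SKSq T R \<longrightarrow>
        (\<exists>V U. derives F P {aw_up} T V \<and>
               derives F P (SKSq - {aw_down, aw_up}) V U \<and>
               derives F P {aw_down} U R)) \<and>
     (\<forall>T R. derives F P SKSq T R \<longrightarrow>
        (\<exists>T1 T2 T3 R3 R2 R1.
           derives F P {ac_up} T T1 \<and>
           derives F P {aw_up} T1 T2 \<and>
           derives F P {ai_down} T2 T3 \<and>
           derives F P {switch, medial, u_down, u_up, l1_down, l1_up, l2_down, l2_up, n_down, n_up}
             T3 R3 \<and>
           derives F P {ai_up} R3 R2 \<and>
           derives F P {aw_down} R2 R1 \<and>
           derives F P {ac_down} R1 R))"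
proof (intro conjI allI impI)
  let ?Q = "insert u_up KQ"
  fix T R :: "('f, 'p) struc"
  assume TR: "derives F P SKSq T R"
  obtain M N K Y where
    up: "derives2 F P {ac_up} {aw_up} T M" "derives2 F P {aw_up} {ac_up} T M" and
    Y: "derives F P {ai_down} TT Y" and Q: "derives F P ?Q (Con [M, Y]) (Dis [K, N])" and
    K: "derives F P {ai_up} K FF" and
    down: "derives2 F P {aw_down} {ac_down} N R" "derives2 F P {ac_down} {aw_down} N R"
    using derivation_decomposition[OF TR] by blast
  have wf: "well_formed F P T" "well_formed F P R" "well_formed F P M" "well_formed F P N"
      "well_formed F P Y" "well_formed F P K"
    using derives_well_formed[OF TR] derives_well_formed[OF Y] derives_well_formed[OF K]
      derives_well_formed[OF Q] by auto
  \<comment> \<open>Here the interactions are placed directly around the middle phase, so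
    contraction and weakening remain outside it.\<close>
  have middle: "derives F P \<S> M N" if "insert ai_down (insert ai_up ?Q) \<subseteq> \<S>" for \<S>
  proof -
    have "derives F P {ai_down} M (Con [M, Y])"
      using Y wf by (intro derives_insert_premise)
    moreover have "derives F P {ai_up} (Dis [K, N]) N"
      using K wf by (intro derives_delete_conclusion)
    ultimately show ?thesis
      using Q that by (meson derives_mono derives_trans insert_subset empty_subsetI)
  qed
  show "\<exists>V U. derives F P {ai_down} T V \<and> derives F P (SKSq - {ai_down, ai_up}) V U \<and>
      derives F P {ai_up} U R"
  proof (intro exI conjI)
    let ?\<S> = "SKSq - {ai_down, ai_up}"
    \<comment> \<open>\<open>Y\<close> is inserted beside \<open>T\<close> instead of
      \<open>M\<close>, and \<open>K\<close> is deleted beside \<open>R\<close> instead of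
      \<open>N\<close>; contraction and weakening then act on the other component within the middle
      phase.\<close>
    show "derives F P {ai_down} T (Con [T, Y])"
      using Y wf by (intro derives_insert_premise)
    show "derives F P {ai_up} (Dis [K, R]) R"
      using K wf by (intro derives_delete_conclusion)
    have "derives F P ?\<S> (Con [T, Y]) (Con [M, Y])"
      using derives2_mono[OF up(1), of ?\<S>] wf by (intro derives_con_left) (auto simp: SKSq_def)
    also have "derives F P ?\<S> \<dots> (Dis [K, N])"
      using Q by (rule derives_mono) (auto simp: SKSq_def KQ_def)
    also have "derives F P ?\<S> \<dots> (Dis [K, R])"
      using derives2_mono[OF down(1), of ?\<S>] wf by (intro derives_dis_right) (auto simp: SKSq_def)
    finally show "derives F P ?\<S> (Con [T, Y]) (Dis [K, R])" .
  qed
  show "\<exists>V U. derives F P {ac_up} T V \<and> derives F P (SKSq - {ac_down, ac_up}) V U \<and>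
      derives F P {ac_down} U R"
  proof -
    let ?\<S> = "SKSq - {ac_down, ac_up}"
    obtain V U where "derives F P {ac_up} T V" "derives F P {aw_up} V M"
      "derives F P {aw_down} N U" "derives F P {ac_down} U R"
      using up(1) down(1) unfolding derives2_def by blast
    moreover have "derives F P ?\<S> M N"
      by (rule middle) (auto simp: SKSq_def KQ_def)
    moreover have "{aw_up} \<subseteq> ?\<S>" "{aw_down} \<subseteq> ?\<S>"
      by (auto simp: SKSq_def)
    ultimately show ?thesis by (meson derives_mono derives_trans)
  qed
  show "\<exists>V U. derives F P {aw_up} T V \<and> derives F P (SKSq - {aw_down, aw_up}) V U \<and>
      derives F P {aw_down} U R"
  proof -
    let ?\<S> = "SKSq - {aw_down, aw_up}"
    \<comment> \<open>The opposite order of the same decomposition, which puts contraction next to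
      the middle phase that absorbs it.\<close>
    obtain V U where "derives F P {aw_up} T V" "derives F P {ac_up} V M"
      "derives F P {ac_down} N U" "derives F P {aw_down} U R"
      using up(2) down(2) unfolding derives2_def by blast
    moreover have "derives F P ?\<S> M N"
      by (rule middle) (auto simp: SKSq_def KQ_def)
    moreover have "{ac_up} \<subseteq> ?\<S>" "{ac_down} \<subseteq> ?\<S>"
      by (auto simp: SKSq_def)
    ultimately show ?thesis by (meson derives_mono derives_trans)
  qed
  show "\<exists>T1 T2 T3 R3 R2 R1.
      derives F P {ac_up} T T1 \<and> derives F P {aw_up} T1 T2 \<and> derives F P {ai_down} T2 T3 \<and>
      derives F P {switch, medial, u_down, u_up, l1_down, l1_up, l2_down, l2_up, n_down, n_up}
        T3 R3 \<and>
      derives F P {ai_up} R3 R2 \<and> derives F P {aw_down} R2 R1 \<and> derives F P {ac_down} R1 R"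
  proof -
    have "derives F P {ai_down} M (Con [M, Y])"
      using Y wf by (intro derives_insert_premise)
    moreover have "derives F P
        {switch, medial, u_down, u_up, l1_down, l1_up, l2_down, l2_up, n_down, n_up}
        (Con [M, Y]) (Dis [K, N])"
      using Q by (rule derives_mono) (auto simp: KQ_def)
    moreover have "derives F P {ai_up} (Dis [K, N]) N"
      using K wf by (intro derives_delete_conclusion)
    ultimately show ?thesis
      using up(1) down(1) unfolding derives2_def by blast
  qed
next
  fix S :: "('f, 'p) struc"
  assume S: "derives F P KSq TT S"
  obtain N where N: "provable F P N"
    "derives2 F P {aw_down} {ac_down} N S" "derives2 F P {ac_down} {aw_down} N S"
    using proof_decomposition[OF S] by blast
  have proof_of: "derives F P \<S> TT N" if "insert ai_down KQ \<subseteq> \<S>" for \<S>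
    using N(1) that unfolding provable_def
    by (meson derives_mono derives_trans insert_subset empty_subsetI)
  show "\<exists>S'. derives F P (KSq - {ac_down}) TT S' \<and> derives F P {ac_down} S' S"
  proof -
    let ?\<S> = "KSq - {ac_down}"
    obtain S' where "derives F P {aw_down} N S'" "derives F P {ac_down} S' S"
      using N(2) unfolding derives2_def by blast
    moreover have "derives F P ?\<S> TT N"
      by (rule proof_of) (auto simp: KSq_def KQ_def)
    moreover have "{aw_down} \<subseteq> ?\<S>" by (auto simp: KSq_def)
    ultimately show ?thesis by (meson derives_mono derives_trans)
  qed
  show "\<exists>S'. derives F P (KSq - {aw_down}) TT S' \<and> derives F P {aw_down} S' S"
  proof -
    let ?\<S> = "KSq - {aw_down}"
    obtain S' where "derives F P {ac_down} N S'" "derives F P {aw_down} S' S"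
      using N(3) unfolding derives2_def by blast
    moreover have "derives F P ?\<S> TT N"
      by (rule proof_of) (auto simp: KSq_def KQ_def)
    moreover have "{ac_down} \<subseteq> ?\<S>" by (auto simp: KSq_def)
    ultimately show ?thesis by (meson derives_mono derives_trans)
  qed
qed

end
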